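(* Let $t_0\in\mathbb{R}$ and $0<\Lambda_1\leq\Lambda_2$ be real numbers, let $S:[t_0,+\infty)\to\mathbb{R}$ be a continuous non-increasing function with $S(t)\to 0$ as $t\to+\infty$, and let $\gamma:[t_0,+\infty)\to\mathbb{R}$ be a continuous monotone function. For every $t\geq t_0$ let $$G(t):=\int_{t_0}^t\gamma(\tau)^2\,d\tau,\qquad M(t):=\max\{G(\tau)S(\tau):\tau\in[t_0,t]\}.$$ Then for every real Hilbert space $\mathcal{H}$, every multiplication operator $A$ on $\mathcal{H}$, every coefficient $c\in\mathcal{PS}(t_0,\Lambda_1,\Lambda_2,S,\gamma)$, and every solution $u$ to $u''(t)+c(t)Au(t)=0$ in $[t_0,+\infty)$, the energy $\mathcal{E}_u(t)$ satisfies the following estimates. (1) If $\gamma$ is non-decreasing, then $$\mathcal{E}_u(t)\leq\mathcal{E}_u(t_0)\cdot H_1\exp\left(H_2M(t)^{1/2}\right)\qquad\forall t\geq t_0,$$ where $$H_1:=\frac{3\Lambda_2}{\Lambda_1},\qquad H_2:=\max\left\{\frac{2(\Lambda_2-\Lambda_1)^{1/2}}{\Lambda_1^2},\frac{(2\Lambda_1+3)^{1/2}}{\Lambda_1^{3/2}}\right\}.$$ (2) If $\gamma$ is non-increasing, then $$\mathcal{E}_u(t)\leq\mathcal{E}_u(t_0)\cdot H_3\exp\left(H_4M(t)^{1/2}\right)\qquad\forall t\geq t_0,$$ where $$H_3:=\max\left\{\frac{3\Lambda_2}{\Lambda_1},\exp\left(\frac{\gamma(t_0)S(t_0)}{2\Lambda_1^2}\right)\right\},\qquad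 H_4:=\frac{(2\Lambda_1+3)^{1/2}}{\Lambda_1^{3/2}}.$$
   Context: Multiplication operators. A linear operator $A$ in a real Hilbert space $\mathcal{H}$ is called a multiplication operator if it is unitarily equivalent to a non-negative multiplication operator in some $L^2$ space: there exist a measure space $(\mathcal{M},\mu)$, a measurable function $\lambda:\mathcal{M}\to[0,+\infty)$ and a surjective linear isometry $\mathscr{F}:\mathcal{H}\to L^2(\mathcal{M},\mu)$ such that $u\in D(A)$ if and only if $\lambda(\xi)^2[\mathscr{F}u](\xi)\in L^2(\mathcal{M},\mu)$, and $[\mathscr{F}(Au)](\xi)=\lambda(\xi)^2[\mathscr{F}u](\xi)$ for every $u\in D(A)$. Correspondingly, $A^{1/2}$ is the operator that acts as multiplication by $\lambda(\xi)$. Admissible propagation speeds. $\mathcal{PS}(t_0,\Lambda_1,\Lambda_2,S,\gamma)$ is the set of all functions $c:[t_0,+\infty)\to\mathbb{R}$ of class $C^2$ such that: - $\Lambda_1\leq c(t)\leq\Lambda_2$ for every $t\geq t_0$; - there exists a real number $c_\infty$ such that $\int_t^{+\infty}|c(\tau)-c_\infty|\,d\tau\leq S(t)$ for every $t\geq t_0$ (such $c_\infty$ is necessarily unique and belongs to $[\Lambda_1,\Lambda_2]$); - $|c'(t)|\leq\gamma(t)$ and $|c''(t)|\leq\gamma(t)^2$ for every $t\geq t_0$. Solutions. A solution to $u''(t)+c(t)Au(t)=0$ is a weak solution $u\in C^0([t_0,+\infty),D(A^{1/2}))\cap C^1([t_0,+\infty),\mathcal{H})$, i.e. for every $\varphi\in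 D(A^{1/2})$ the function $t\mapsto\langle u'(t),\varphi\rangle$ is differentiable with derivative $-c(t)\langle A^{1/2}u(t),A^{1/2}\varphi\rangle$. Energy. For a solution $u$ corresponding to a coefficient $c$ with constant $c_\infty$, $$\mathcal{E}_u(t):=\frac{\|u'(t)\|_{\mathcal{H}}^2}{c_\infty^{1/2}}+c_\infty^{1/2}\|A^{1/2}u(t)\|_{\mathcal{H}}^2.$$ *)

theory Defs
  imports "HOL-Analysis.Analysis"
begin

text \<open>
  Elements of \<open>L\<^sup>2(M)\<close> are handled through representatives; equality of elements is
  equality almost everywhere.
\<close>

definition L2 :: "'x measure \<Rightarrow> ('x \<Rightarrow> real) set" where
  "L2 M = {f \<in> borel_measurable M. integrable M (\<lambda>x. (f x)\<^sup>2)}"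

definition L2_surj_isometry :: "'x measure \<Rightarrow> ('h::real_inner \<Rightarrow> 'x \<Rightarrow> real) \<Rightarrow> bool" where
  "L2_surj_isometry M F \<longleftrightarrow>
     (\<forall>u. F u \<in> L2 M) \<and>
     (\<forall>u v. AE x in M. F (u + v) x = F u x + F v x) \<and>
     (\<forall>a u. AE x in M. F (a *\<^sub>R u) x = a * F u x) \<and>
     (\<forall>u. norm u = sqrt (\<integral>x. (F u x)\<^sup>2 \<partial>M)) \<and>
     (\<forall>f\<in>L2 M. \<exists>u. AE x in M. F u x = f x)"

definition linear_operator_on :: "'h::real_vector set \<Rightarrow> ('h \<Rightarrow> 'h) \<Rightarrow> bool" where
  "linear_operator_on D A \<longleftrightarrow>
     subspace D \<and>
     (\<forall>u\<in>D. \<forall>v\<in>D. A (u + v) = A u + A v) \<and>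
     (\<forall>a. \<forall>u\<in>D. A (a *\<^sub>R u) = a *\<^sub>R A u)"

text \<open>
  An unbounded operator is a domain \<open>D\<close> together with a total function \<open>A\<close> whose values
  outside \<open>D\<close> are irrelevant. The measure space, the multiplier and the isometry are
  explicit parameters, because one cannot quantify existentially over the type \<open>'x\<close>, and
  because the square root is defined through them. A theorem that
  assumes this predicate for arbitrary \<open>M\<close>, \<open>lam\<close>, \<open>F\<close> covers every multiplication operator
  and every way of representing it.
\<close>

definition multiplication_operator ::
  "'x measure \<Rightarrow> ('x \<Rightarrow> real) \<Rightarrow> ('h::real_inner \<Rightarrow> 'x \<Rightarrow> real) \<Rightarrow> 'h set \<Rightarrow> ('h \<Rightarrow> 'h) \<Rightarrow> bool"
where
  "multiplication_operator M lam F D A \<longleftrightarrow>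
     linear_operator_on D A \<and>
     lam \<in> borel_measurable M \<and> (\<forall>x\<in>space M. 0 \<le> lam x) \<and>
     L2_surj_isometry M F \<and>
     (\<forall>u. u \<in> D \<longleftrightarrow> (\<lambda>x. (lam x)\<^sup>2 * F u x) \<in> L2 M) \<and>
     (\<forall>u\<in>D. AE x in M. F (A u) x = (lam x)\<^sup>2 * F u x)"

definition sqrt_dom ::
  "'x measure \<Rightarrow> ('x \<Rightarrow> real) \<Rightarrow> ('h::real_inner \<Rightarrow> 'x \<Rightarrow> real) \<Rightarrow> 'h set" where
  "sqrt_dom M lam F = {u. (\<lambda>x. lam x * F u x) \<in> L2 M}"

text \<open>On \<open>sqrt_dom\<close> the description is proper: \<open>F\<close> is onto and injective up to null sets.\<close>

definition sqrt_op ::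
  "'x measure \<Rightarrow> ('x \<Rightarrow> real) \<Rightarrow> ('h::real_inner \<Rightarrow> 'x \<Rightarrow> real) \<Rightarrow> 'h \<Rightarrow> 'h" where
  "sqrt_op M lam F u = (THE v. AE x in M. F v x = lam x * F u x)"

text \<open>
  Functions on the half-line from \<open>t0\<close> are total functions constrained only on \<open>{t0..}\<close>;
  derivatives within \<open>{t0..}\<close> are one-sided at \<open>t0\<close>.
\<close>

definition limit_speed :: "real \<Rightarrow> (real \<Rightarrow> real) \<Rightarrow> (real \<Rightarrow> real) \<Rightarrow> real \<Rightarrow> bool" where
  "limit_speed t0 S c cinf \<longleftrightarrow>
     (\<forall>t\<ge>t0. (\<lambda>\<tau>. \<bar>c \<tau> - cinf\<bar>) integrable_on {t..} \<and>
             integral {t..} (\<lambda>\<tau>. \<bar>c \<tau> - cinf\<bar>) \<le> S t)"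

definition PS ::
  "real \<Rightarrow> real \<Rightarrow> real \<Rightarrow> (real \<Rightarrow> real) \<Rightarrow> (real \<Rightarrow> real) \<Rightarrow> (real \<Rightarrow> real) set" where
  "PS t0 \<Lambda>1 \<Lambda>2 S \<gamma> = {c.
     (\<forall>t\<ge>t0. \<Lambda>1 \<le> c t \<and> c t \<le> \<Lambda>2) \<and>
     (\<exists>cinf. limit_speed t0 S c cinf) \<and>
     (\<exists>c' c''.
        (\<forall>t\<ge>t0. (c has_real_derivative c' t) (at t within {t0..})) \<and>
        (\<forall>t\<ge>t0. (c' has_real_derivative c'' t) (at t within {t0..})) \<and>
        continuous_on {t0..} c'' \<and>
        (\<forall>t\<ge>t0. \<bar>c' t\<bar> \<le> \<gamma> t \<and> \<bar>c'' t\<bar> \<le> (\<gamma> t)\<^sup>2))}"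

text \<open>
  Here \<open>D\<close> and \<open>B\<close> are the domain and the action of \<open>A\<^sup>1\<^sup>/\<^sup>2\<close>, and \<open>u'\<close> is the derivative
  of \<open>u\<close>. Continuity with values in \<open>D\<close> refers to the graph norm, that is, continuity of both
  \<open>u\<close> and \<open>B u\<close>.
\<close>

definition weak_solution ::
  "'h::real_inner set \<Rightarrow> ('h \<Rightarrow> 'h) \<Rightarrow> real \<Rightarrow> (real \<Rightarrow> real) \<Rightarrow> (real \<Rightarrow> 'h) \<Rightarrow> (real \<Rightarrow> 'h) \<Rightarrow> bool"
where
  "weak_solution D B t0 c u u' \<longleftrightarrow>
     (\<forall>t\<ge>t0. u t \<in> D) \<and>
     continuous_on {t0..} u \<and> continuous_on {t0..} (\<lambda>t. B (u t)) \<and>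
     (\<forall>t\<ge>t0. (u has_vector_derivative u' t) (at t within {t0..})) \<and>
     continuous_on {t0..} u' \<and>
     (\<forall>\<phi>\<in>D. \<forall>t\<ge>t0. ((\<lambda>s. inner (u' s) \<phi>) has_real_derivative
        - c t * inner (B (u t)) (B \<phi>)) (at t within {t0..}))"

definition energy ::
  "('h::real_inner \<Rightarrow> 'h) \<Rightarrow> real \<Rightarrow> (real \<Rightarrow> 'h) \<Rightarrow> (real \<Rightarrow> 'h) \<Rightarrow> real \<Rightarrow> real" where
  "energy B cinf u u' t =
     (norm (u' t))\<^sup>2 / sqrt cinf + sqrt cinf * (norm (B (u t)))\<^sup>2"

definition G_fun :: "real \<Rightarrow> (real \<Rightarrow> real) \<Rightarrow> real \<Rightarrow> real" where
  "G_fun t0 \<gamma> t = integral {t0..t} (\<lambda>\<tau>. (\<gamma> \<tau>)\<^sup>2)"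

text \<open>For continuous \<open>S\<close> and \<open>\<gamma>\<close> this supremum over a compact interval is a maximum.\<close>

definition M_fun :: "real \<Rightarrow> (real \<Rightarrow> real) \<Rightarrow> (real \<Rightarrow> real) \<Rightarrow> real \<Rightarrow> real" where
  "M_fun t0 S \<gamma> t = (SUP \<tau>\<in>{t0..t}. G_fun t0 \<gamma> \<tau> * S \<tau>)"

end

theory Submission
  imports Defs
begin

text \<open>
  At a single frequency \<open>\<lambda>\<close> the equation is \<open>y'' + \<lambda>\<^sup>2 c y = 0\<close>, and two energies control it.
  The Kovaleskian energy \<open>E = y'\<^sup>2 / \<surd>cinf + \<surd>cinf \<lambda>\<^sup>2 y\<^sup>2\<close> grows over \<open>[s, t]\<close> at most by the factor
  \<open>exp (\<lambda> / \<surd>\<Lambda>1 \<integral> \<bar>c - cinf\<bar>) \<le> exp (\<lambda> S s / \<surd>\<Lambda>1)\<close>, which is good at low frequency or late times.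
  The Tarama energy \<open>T = y'\<^sup>2 / \<surd>c + \<surd>c \<lambda>\<^sup>2 y\<^sup>2 + c' / (2 c \<surd>c) y y'\<close> is built so that every term of
  its derivative without \<open>c''\<close> or \<open>c'\<^sup>2\<close> cancels. It is comparable with \<open>E\<close> as long as
  \<open>\<gamma> \<le> \<kappa> \<lambda>\<close>, where \<open>\<kappa> = 2 \<Lambda>1 \<surd>\<Lambda>1\<close>, and under this condition it grows over \<open>[t0, s]\<close> at most
  by \<open>exp (K G s / \<lambda>)\<close>, \<open>K\<close> depending on \<open>\<Lambda>1\<close> only, which is good at high frequency or early times. The comparison costs the
  factor \<open>3 \<Lambda>2 / \<Lambda>1\<close>.

  One uses \<open>T\<close> up to the time \<open>s\<close> at which the two exponents agree, and \<open>E\<close> afterwards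
  (\<open>balanced_estimate\<close>). At this \<open>s\<close> the sum of the exponents is twice their
  geometric mean, \<open>2 \<surd>(K / \<surd>\<Lambda>1) \<surd>(G s S s) \<le> H\<^sub>4 \<surd>M\<close>: the frequency has disappeared. There
  remain the frequencies for which \<open>\<gamma>\<close> exceeds \<open>\<kappa> \<lambda>\<close> too early. If \<open>\<gamma>\<close> is non-increasing, then
  \<open>\<kappa> \<lambda> < \<gamma> t0\<close>, and \<open>E\<close> alone from \<open>t0\<close> on gives the second entry of \<open>H\<^sub>3\<close>. If \<open>\<gamma>\<close> is
  non-decreasing, one switches to \<open>E\<close> already when \<open>\<gamma> = \<kappa> \<lambda>\<close>; after that time \<open>G\<close> grows
  at least at the rate \<open>(\<kappa> \<lambda>)\<^sup>2\<close>, which pays for the gap between \<open>c\<close> and \<open>cinf\<close>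
  (\<open>second_phase\<close>) and accounts for the first entry of \<open>H\<^sub>2\<close>.

  Components \<open>F u t \<xi>\<close> of a weak solution are only defined for almost every \<open>\<xi>\<close>, separately for each
  \<open>t\<close>, so they cannot be differentiated directly. Instead the spectrum is cut into bands
  \<open>[a, q a]\<close> with \<open>q > 1\<close>, plus the set where \<open>lam = 0\<close>. On a band the square root \<open>R\<close> of the
  operator is bounded, the projected solution is a classical one, and the argument above works for
  the four scalar functions \<open>\<parallel>u'\<parallel>\<^sup>2\<close>, \<open>\<parallel>R u\<parallel>\<^sup>2\<close>, \<open>\<langle>R u, R u'\<rangle>\<close>, \<open>\<langle>u, u'\<rangle>\<close> of the projection, all
  exponents being enlarged by the factor \<open>q\<close>. The energy is the sum of the energies of the bands
  (\<open>norm_sq_sums_bands\<close>), so it inherits the estimate (\<open>energy_le_of_bands\<close>), and finally \<open>q\<close>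
  tends to \<open>1\<close>.
\<close>

section \<open>Tools from one-variable analysis\<close>

lemma gronwall_within:
  fixes f f' k :: "real \<Rightarrow> real"
  assumes "s \<le> t" and k: "continuous_on {s..t} k"
    and f: "\<And>x. x \<in> {s..t} \<Longrightarrow> (f has_real_derivative f' x) (at x within {s..t})"
    and le: "\<And>x. x \<in> {s..t} \<Longrightarrow> f' x \<le> k x * f x"
  shows "f t \<le> f s * exp (integral {s..t} k)"
proof -
  define I where "I x = integral {s..x} k" for x
  define g where "g x = f x * exp (- I x)" for x
  have I: "(I has_real_derivative k x) (at x within {s..t})" if "x \<in> {s..t}" for x
    unfolding I_def using integral_has_real_derivative[OF k that] .
  have g: "(g has_real_derivative (f' x - k x * f x) * exp (- I x)) (at x within {s..t})"
    if "x \<in> {s..t}" for x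
    unfolding g_def by (rule derivative_eq_intros f I that refl | simp add: that algebra_simps)+
  have "continuous_on {s..t} g"
    by (rule DERIV_continuous_on[OF g]) auto
  moreover have "\<exists>y. (g has_real_derivative y) (at x) \<and> y \<le> 0" if "s < x" "x < t" for x
  proof -
    have "at x within {s..t} = at x"
      using that by (intro at_within_interior) auto
    then show ?thesis
      using g[of x] le[of x] that by (auto intro!: exI mult_nonpos_nonneg)
  qed
  ultimately have "g t \<le> g s"
    using \<open>s \<le> t\<close> by (intro DERIV_nonpos_imp_decreasing_open[of s t g]) auto
  then show ?thesis
    by (simp add: g_def I_def exp_minus divide_simps)
qed

text \<open>
  The increment \<open>v s - v t - (s - t) g t\<close> is tested against itself. The scalar mean value theorem
  then bounds its norm by \<open>\<bar>s - t\<bar>\<close> times the oscillation of \<open>g\<close>.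
\<close>

lemma weak_derivative_imp_strong:
  fixes v g :: "real \<Rightarrow> 'h::real_inner"
  assumes g: "continuous_on {t0..} g"
    and v: "\<And>\<phi> t. t0 \<le> t \<Longrightarrow>
      ((\<lambda>s. inner (v s) \<phi>) has_real_derivative inner (g t) \<phi>) (at t within {t0..})"
    and "t0 \<le> t"
  shows "(v has_vector_derivative g t) (at t within {t0..})"
  unfolding has_vector_derivative_def has_derivative_within_alt
proof (intro conjI allI impI)
  show "bounded_linear (\<lambda>h. h *\<^sub>R g t)"
    by (rule bounded_linear_scaleR_left)
  fix e :: real assume "e > 0"
  obtain d where "d > 0" and d: "\<And>s. s \<in> {t0..} \<Longrightarrow> dist s t < d \<Longrightarrow> dist (g s) (g t) < e"
    using g \<open>t0 \<le> t\<close> \<open>e > 0\<close> unfolding continuous_on_iff by (meson atLeast_iff)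
  have "norm (v s - v t - (s - t) *\<^sub>R g t) \<le> e * norm (s - t)" if s: "s \<in> {t0..}" "norm (s - t) < d" for s
  proof -
    define \<phi> where "\<phi> = v s - v t - (s - t) *\<^sub>R g t"
    define h where "h x = inner (v x) \<phi> - x * inner (g t) \<phi>" for x
    have h: "(h has_field_derivative (inner (g x - g t) \<phi>)) (at x within {t0..} \<inter> ball t d)"
      if "x \<in> {t0..} \<inter> ball t d" for x
      unfolding h_def using that
      by (auto intro!: derivative_eq_intros DERIV_subset[OF v] simp: inner_diff_left)
    have "norm (h s - h t) \<le> (e * norm \<phi>) * norm (s - t)"
    proof (rule field_differentiable_bound[OF _ h])
      show "convex ({t0..} \<inter> ball t d)"
        by (intro convex_Int convex_ball) simp
      show "norm (inner (g x - g t) \<phi>) \<le> e * norm \<phi>" if "x \<in> {t0..} \<inter> ball t d" for x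
      proof -
        have "norm (g x - g t) \<le> e"
          using d[of x] that by (auto simp: dist_norm norm_minus_commute abs_minus_commute less_imp_le)
        then show ?thesis
          using Cauchy_Schwarz_ineq2[of "g x - g t" \<phi>]
          by (metis mult_right_mono norm_ge_zero order_trans real_norm_def)
      qed
    qed (use s \<open>d > 0\<close> \<open>t0 \<le> t\<close> in \<open>auto simp: dist_norm norm_minus_commute\<close>)
    moreover have "h s - h t = inner \<phi> \<phi>"
      by (simp add: h_def \<phi>_def algebra_simps inner_diff_left)
    ultimately have "norm \<phi> * norm \<phi> \<le> (e * norm (s - t)) * norm \<phi>"
      by (simp add: power2_norm_eq_inner[symmetric] power2_eq_square mult_ac)
    then show ?thesis
      unfolding \<phi>_def[symmetric] using \<open>e > 0\<close>
      by (cases "\<phi> = 0") auto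
  qed
  then show "\<exists>d>0. \<forall>y\<in>{t0..}. norm (y - t) < d \<longrightarrow> norm (v y - v t - (y - t) *\<^sub>R g t) \<le> e * norm (y - t)"
    using \<open>d > 0\<close> by blast
qed

lemma has_real_derivative_inner:
  fixes f g :: "real \<Rightarrow> 'h::real_inner"
  assumes "(f has_vector_derivative f') (at t within T)" "(g has_vector_derivative g') (at t within T)"
  shows "((\<lambda>s. inner (f s) (g s)) has_real_derivative (inner (f t) g' + inner f' (g t))) (at t within T)"
  unfolding has_field_derivative_def
  by (rule has_derivative_eq_rhs[OF has_derivative_inner[OF assms[unfolded has_vector_derivative_def]]])
    (simp add: fun_eq_iff algebra_simps)

text \<open>
  Either two competing quantities balance at some time, or one stays dominated until the final
  time; \<open>f\<close> is their difference.
\<close>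

lemma balance_point:
  fixes f :: "real \<Rightarrow> real"
  assumes "s \<le> t" "continuous_on {s..t} f" "f s \<le> 0"
  obtains r where "s \<le> r" "r \<le> t" "f r \<le> 0" "r = t \<or> f r = 0"
proof (cases "f t \<le> 0")
  case True
  then show ?thesis using that[of t] assms by simp
next
  case False
  then obtain r where "s \<le> r" "r \<le> t" "f r = 0"
    using IVT'[of f s 0 t] assms by auto
  then show ?thesis using that[of r] by simp
qed

section \<open>Propagation speeds\<close>

locale speed =
  fixes t0 \<Lambda>1 \<Lambda>2 cinf :: real and S \<gamma> c c' c'' :: "real \<Rightarrow> real"
  assumes \<Lambda>1_pos: "0 < \<Lambda>1"
    and S_cont: "continuous_on {t0..} S" and S_anti: "antimono_on {t0..} S"
    and \<gamma>_cont: "continuous_on {t0..} \<gamma>"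
    and c_bounds: "t0 \<le> t \<Longrightarrow> \<Lambda>1 \<le> c t" "t0 \<le> t \<Longrightarrow> c t \<le> \<Lambda>2"
    and c_deriv: "t0 \<le> t \<Longrightarrow> (c has_real_derivative c' t) (at t within {t0..})"
    and c'_deriv: "t0 \<le> t \<Longrightarrow> (c' has_real_derivative c'' t) (at t within {t0..})"
    and c'_bound: "t0 \<le> t \<Longrightarrow> \<bar>c' t\<bar> \<le> \<gamma> t"
    and c''_bound: "t0 \<le> t \<Longrightarrow> \<bar>c'' t\<bar> \<le> (\<gamma> t)\<^sup>2"
    and limit: "limit_speed t0 S c cinf"
begin

lemma c_cont: "continuous_on {t0..} c"
  by (rule DERIV_continuous_on[OF c_deriv]) auto

lemma \<gamma>_nonneg: "t0 \<le> t \<Longrightarrow> 0 \<le> \<gamma> t"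
  using c'_bound[of t] by linarith

lemma gap_integrable: "t0 \<le> s \<Longrightarrow> (\<lambda>x. \<bar>c x - cinf\<bar>) integrable_on {s..t}"
  by (intro integrable_continuous_real continuous_intros continuous_on_subset[OF c_cont]) auto

lemma gap_integral_le: 
  assumes "t0 \<le> s" shows "integral {s..t} (\<lambda>x. \<bar>c x - cinf\<bar>) \<le> S s"
proof -
  have "integral {s..t} (\<lambda>x. \<bar>c x - cinf\<bar>) \<le> integral {s..} (\<lambda>x. \<bar>c x - cinf\<bar>)"
    using limit assms by (intro integral_subset_le gap_integrable) (auto simp: limit_speed_def)
  then show ?thesis
    using limit assms unfolding limit_speed_def by force
qed

lemma S_nonneg: "t0 \<le> t \<Longrightarrow> 0 \<le> S t"
  using gap_integral_le[of t t] by simp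

text \<open>
  If \<open>cinf\<close> were outside \<open>[\<Lambda>1, \<Lambda>2]\<close>, then \<open>\<bar>c - cinf\<bar>\<close> would stay away from \<open>0\<close> and could not be
  integrable on a half-line.
\<close>

lemma cinf_bounds: "\<Lambda>1 \<le> cinf" "cinf \<le> \<Lambda>2"
proof -
  have False if "\<delta> > 0" "\<And>x. t0 \<le> x \<Longrightarrow> \<delta> \<le> \<bar>c x - cinf\<bar>" for \<delta>
  proof -
    obtain n :: nat where n: "S t0 < n * \<delta>"
      using \<open>\<delta> > 0\<close> reals_Archimedean3 by blast
    have "integral {t0..t0 + n} (\<lambda>x. \<delta>) \<le> integral {t0..t0 + n} (\<lambda>x. \<bar>c x - cinf\<bar>)"
      using that by (intro integral_le gap_integrable) auto
    then show False using gap_integral_le[of t0 "t0 + n"] n by simp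
  qed
  from this[of "\<Lambda>1 - cinf"] this[of "cinf - \<Lambda>2"] show "\<Lambda>1 \<le> cinf" "cinf \<le> \<Lambda>2"
    using c_bounds by force+
qed

lemma \<Lambda>1_le_\<Lambda>2: "\<Lambda>1 \<le> \<Lambda>2"
  using cinf_bounds by simp

lemma gap_integral_le_length:
  assumes "t0 \<le> s" "s \<le> t"
  shows "integral {s..t} (\<lambda>x. \<bar>c x - cinf\<bar>) \<le> (\<Lambda>2 - \<Lambda>1) * (t - s)"
proof -
  have "\<bar>c x - cinf\<bar> \<le> \<Lambda>2 - \<Lambda>1" if "x \<in> {s..t}" for x
    using c_bounds[of x] cinf_bounds assms that by (auto simp: abs_le_iff)
  then have "integral {s..t} (\<lambda>x. \<bar>c x - cinf\<bar>) \<le> integral {s..t} (\<lambda>x. \<Lambda>2 - \<Lambda>1)"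
    using assms by (intro integral_le gap_integrable) auto
  then show ?thesis using assms by (simp add: mult.commute)
qed

abbreviation "G \<equiv> G_fun t0 \<gamma>"
abbreviation "MM \<equiv> M_fun t0 S \<gamma>"

lemma \<gamma>2_integrable: "t0 \<le> s \<Longrightarrow> (\<lambda>x. (\<gamma> x)\<^sup>2) integrable_on {s..t}"
  by (intro integrable_continuous_real continuous_intros continuous_on_subset[OF \<gamma>_cont]) auto

lemma G_cont: "continuous_on {t0..t} G"
  unfolding G_fun_def[abs_def] by (intro indefinite_integral_continuous_1 \<gamma>2_integrable) simp

lemma G_nonneg: "0 \<le> G t"
  unfolding G_fun_def by (cases "(\<lambda>x. (\<gamma> x)\<^sup>2) integrable_on {t0..t}")
    (auto intro!: integral_nonneg simp: not_integrable_integral)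

lemma G_diff: "t0 \<le> s \<Longrightarrow> s \<le> t \<Longrightarrow> G t = G s + integral {s..t} (\<lambda>x. (\<gamma> x)\<^sup>2)"
  unfolding G_fun_def
  by (intro Henstock_Kurzweil_Integration.integral_combine[symmetric] \<gamma>2_integrable) auto

lemma G_mono: "t0 \<le> s \<Longrightarrow> s \<le> t \<Longrightarrow> G s \<le> G t"
  using G_diff[of s t] integral_nonneg[OF \<gamma>2_integrable[of s t]] by simp

lemma GS_le_M:
  assumes "t0 \<le> s" "s \<le> t" shows "G s * S s \<le> MM t"
  unfolding M_fun_def
proof (rule cSUP_upper)
  have "continuous_on {t0..t} (\<lambda>x. G x * S x)"
    by (intro continuous_intros G_cont continuous_on_subset[OF S_cont]) auto
  then have "compact ((\<lambda>x. G x * S x) ` {t0..t})"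
    by (intro compact_continuous_image) auto
  then show "bdd_above ((\<lambda>x. G x * S x) ` {t0..t})"
    by (intro bounded_imp_bdd_above compact_imp_bounded)
qed (use assms in auto)

lemma M_nonneg: "t0 \<le> t \<Longrightarrow> 0 \<le> MM t"
  using GS_le_M[of t t] G_nonneg[of t] S_nonneg[of t] by (meson mult_nonneg_nonneg order_refl order_trans)

text \<open>
  For \<open>\<gamma> \<le> \<kappa> a\<close> the correction term of the Tarama energy at frequencies above \<open>a\<close> is at most half
  of the principal part; \<open>K / a\<close> is the rate at which that energy grows, relative to \<open>\<gamma>\<^sup>2\<close>.
\<close>

definition "\<kappa> = 2 * \<Lambda>1 * sqrt \<Lambda>1"
definition "K = (2 * \<Lambda>1 + 3) / (4 * \<Lambda>1\<^sup>2 * sqrt \<Lambda>1)"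

lemma \<kappa>_pos: "0 < \<kappa>" and K_pos: "0 < K"
  using \<Lambda>1_pos by (simp_all add: \<kappa>_def K_def)

lemma H4_eq: "sqrt (2 * \<Lambda>1 + 3) / \<Lambda>1 powr (3/2) = 2 * sqrt (K / sqrt \<Lambda>1)"
proof -
  have p: "\<Lambda>1 powr (3/2) = \<Lambda>1 * sqrt \<Lambda>1"
    using \<Lambda>1_pos powr_add[of \<Lambda>1 1 "1/2"] by (simp add: powr_half_sqrt)
  have "K / sqrt \<Lambda>1 = (2 * \<Lambda>1 + 3) / (2 * \<Lambda>1 * sqrt \<Lambda>1)\<^sup>2"
    using \<Lambda>1_pos by (simp add: K_def field_simps power2_eq_square)
  then have "sqrt (K / sqrt \<Lambda>1) = sqrt (2 * \<Lambda>1 + 3) / (2 * \<Lambda>1 * sqrt \<Lambda>1)"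
    using \<Lambda>1_pos by (simp add: real_sqrt_divide)
  then show ?thesis using p by simp
qed

end

section \<open>The energy of one frequency band\<close>

definition weighted_energy :: "real \<Rightarrow> real \<Rightarrow> real \<Rightarrow> real" where
  "weighted_energy k x y = x / sqrt k + sqrt k * y"

lemma two_sqrt_le_weighted_energy:
  assumes "0 < k" "0 \<le> x" "0 \<le> y"
  shows "2 * sqrt (x * y) \<le> weighted_energy k x y"
  using arith_geo_mean_sqrt[of "x / sqrt k" "sqrt k * y"] assms
  by (simp add: weighted_energy_def)

text \<open>
  Of the two ratios \<open>\<surd>k2 / \<surd>k1\<close> and \<open>\<surd>k1 / \<surd>k2\<close> between the weights, each is at most
  \<open>\<surd>L / \<surd>l\<close>.
\<close>

lemma weighted_energy_le_ratio:
  assumes "0 < l" "l \<le> k1" "k1 \<le> L" "l \<le> k2" "k2 \<le> L" "0 \<le> x" "0 \<le> y"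
  shows "weighted_energy k1 x y \<le> sqrt (L / l) * weighted_energy k2 x y"
proof -
  have "x / sqrt k1 \<le> x / sqrt l"
    using assms by (intro divide_left_mono) auto
  also have "\<dots> \<le> sqrt (L / l) * (x / sqrt k2)"
  proof -
    have "x / sqrt l * (sqrt k2 / sqrt k2) \<le> x / sqrt l * (sqrt L / sqrt k2)"
      using assms by (intro mult_left_mono divide_right_mono) auto
    then show ?thesis using assms by (simp add: real_sqrt_divide mult_ac)
  qed
  finally have 1: "x / sqrt k1 \<le> sqrt (L / l) * (x / sqrt k2)" .
  have "sqrt k1 * y \<le> sqrt L * y"
    using assms by (intro mult_right_mono) auto
  also have "\<dots> \<le> sqrt (L / l) * (sqrt k2 * y)"
  proof -
    have "sqrt L * y * 1 \<le> sqrt L * y * (sqrt k2 / sqrt l)"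
      using assms by (intro mult_left_mono) (auto simp: divide_simps)
    then show ?thesis using assms by (simp add: real_sqrt_divide mult_ac)
  qed
  finally show ?thesis using 1 by (simp add: weighted_energy_def distrib_left)
qed

text \<open>
  For a projection \<open>v\<close> of a solution onto frequencies at most \<open>b\<close>, and with \<open>R\<close> for the square
  root of the operator, \<open>X = \<parallel>v'\<parallel>\<^sup>2\<close>, \<open>Y = \<parallel>R v\<parallel>\<^sup>2\<close> and \<open>V = \<langle>R v, R v'\<rangle>\<close>. These equations and
  bounds are all that the energy estimates use.
\<close>

locale band = speed +
  fixes X Y V :: "real \<Rightarrow> real" and b :: real
  assumes X_nonneg: "0 \<le> X t" and Y_nonneg: "0 \<le> Y t" and b_nonneg: "0 \<le> b"
    and X_deriv: "t0 \<le> t \<Longrightarrow> (X has_real_derivative (- 2 * c t * V t)) (at t within {t0..})"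
    and Y_deriv: "t0 \<le> t \<Longrightarrow> (Y has_real_derivative (2 * V t)) (at t within {t0..})"
    and V_bound: "\<bar>V t\<bar> \<le> b * sqrt (X t * Y t)"
begin

definition "E t = weighted_energy cinf (X t) (Y t)"

lemma E_nonneg: "0 \<le> E t"
  unfolding E_def weighted_energy_def using X_nonneg Y_nonneg \<Lambda>1_pos cinf_bounds by simp

text \<open>
  In \<open>E' = 2 V (cinf - c) / \<surd>cinf\<close> the product \<open>2 V\<close> is at most \<open>b E\<close>, because \<open>E\<close> dominates
  \<open>2 \<surd>(X Y)\<close>.
\<close>

lemma kovaleskian_estimate:
  assumes "t0 \<le> s" "s \<le> t"
  shows "E t \<le> E s * exp (b / sqrt \<Lambda>1 * integral {s..t} (\<lambda>x. \<bar>c x - cinf\<bar>))"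
proof -
  have pos: "0 < sqrt \<Lambda>1" "sqrt \<Lambda>1 \<le> sqrt cinf" "0 < cinf"
    using \<Lambda>1_pos cinf_bounds by auto
  have "E t \<le> E s * exp (integral {s..t} (\<lambda>x. b / sqrt \<Lambda>1 * \<bar>c x - cinf\<bar>))"
  proof (rule gronwall_within[where f' = "\<lambda>x. 2 * V x * (cinf - c x) / sqrt cinf"])
    show "continuous_on {s..t} (\<lambda>x. b / sqrt \<Lambda>1 * \<bar>c x - cinf\<bar>)"
      using assms pos by (intro continuous_intros continuous_on_subset[OF c_cont]) auto
    fix x assume "x \<in> {s..t}"
    then have x: "t0 \<le> x" using assms by simp
    have "(E has_real_derivative (- 2 * c x * V x) / sqrt cinf + sqrt cinf * (2 * V x)) (at x within {t0..})"
      unfolding E_def[abs_def] weighted_energy_def 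
      by (intro derivative_intros DERIV_cdivide DERIV_cmult X_deriv Y_deriv x)
    moreover have "(- 2 * c x * V x) / sqrt cinf + sqrt cinf * (2 * V x) = 2 * V x * (cinf - c x) / sqrt cinf"
      using pos by (simp add: field_simps)
    ultimately show "(E has_real_derivative 2 * V x * (cinf - c x) / sqrt cinf) (at x within {s..t})"
      using assms by (auto intro: DERIV_subset)
    have "2 * V x * (cinf - c x) / sqrt cinf \<le> 2 * \<bar>V x\<bar> * \<bar>c x - cinf\<bar> / sqrt cinf"
      using pos abs_ge_self[of "V x * (cinf - c x)"]
      by (intro divide_right_mono) (auto simp: abs_mult abs_minus_commute)
    also have "\<dots> \<le> (b * E x) * \<bar>c x - cinf\<bar> / sqrt cinf"
    proof -
      have "2 * \<bar>V x\<bar> \<le> b * (2 * sqrt (X x * Y x))"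
        using V_bound[of x] by simp
      also have "\<dots> \<le> b * E x"
        unfolding E_def using pos
        by (intro mult_left_mono two_sqrt_le_weighted_energy X_nonneg Y_nonneg b_nonneg)
      finally show ?thesis
        using pos by (intro divide_right_mono mult_right_mono) auto
    qed
    also have "\<dots> \<le> (b * E x) * \<bar>c x - cinf\<bar> / sqrt \<Lambda>1"
      using pos E_nonneg[of x] b_nonneg by (intro divide_left_mono) auto
    finally show "2 * V x * (cinf - c x) / sqrt cinf \<le> b / sqrt \<Lambda>1 * \<bar>c x - cinf\<bar> * E x"
      by (simp add: mult_ac)
  qed (use assms in auto)
  then show ?thesis by simp
qed

end

text \<open>
  Frequencies in addition bounded below by \<open>a > 0\<close>; \<open>W = \<langle>v, v'\<rangle>\<close> is controlled by the energy
  only because of this lower bound.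
\<close>

locale positive_band = band +
  fixes W :: "real \<Rightarrow> real" and a :: real
  assumes a_pos: "0 < a"
    and W_deriv: "t0 \<le> t \<Longrightarrow> (W has_real_derivative (X t - c t * Y t)) (at t within {t0..})"
    and W_bound: "a * \<bar>W t\<bar> \<le> sqrt (X t * Y t)"
begin

text \<open>
  The coefficient of \<open>W\<close> in the Tarama energy \<open>T\<close> is forced: the terms of \<open>T'\<close> that contain
  \<open>c'\<close> to the first power, namely \<open>- c' / (2 c \<surd>c) X + c' / (2 \<surd>c) Y\<close>, must cancel against
  \<open>corr (X - c Y)\<close>.
\<close>

definition "corr t = c' t / (2 * c t * sqrt (c t))"
definition "E0 t = weighted_energy (c t) (X t) (Y t)"
definition "T t = E0 t + corr t * W t"

lemma c_pos: "t0 \<le> t \<Longrightarrow> 0 < c t"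
  using c_bounds[of t] \<Lambda>1_pos by linarith

lemma corr_bound: "t0 \<le> t \<Longrightarrow> \<bar>corr t\<bar> \<le> \<gamma> t / \<kappa>"
  unfolding corr_def \<kappa>_def abs_divide using c_pos[of t] c_bounds[of t] \<Lambda>1_pos c'_bound[of t] \<gamma>_nonneg[of t]
  by (intro frac_le) (auto simp: abs_mult intro!: mult_mono)

lemma corr_deriv:
  assumes "t0 \<le> t"
  shows "(corr has_real_derivative
    c'' t / (2 * c t * sqrt (c t)) - 3 * (c' t)\<^sup>2 / (4 * (c t)\<^sup>2 * sqrt (c t))) (at t within {t0..})"
proof -
  define s where "s = sqrt (c t)"
  have s: "c t = s\<^sup>2" "0 < s" using c_pos[OF assms] by (auto simp: s_def)
  have "((\<lambda>t. sqrt (c t)) has_real_derivative c' t / (2 * s)) (at t within {t0..})"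
    using c_pos[OF assms] unfolding s_def
    by (auto intro!: derivative_eq_intros c_deriv assms simp: field_simps)
  then have "((\<lambda>t. 2 * c t * sqrt (c t)) has_real_derivative (2 * c' t) * s + c' t / (2 * s) * (2 * c t))
      (at t within {t0..})"
    unfolding s_def by (intro DERIV_mult DERIV_cmult c_deriv assms)
  then have "(corr has_real_derivative
      (c'' t * (2 * c t * s) - c' t * ((2 * c' t) * s + c' t / (2 * s) * (2 * c t)))
        / ((2 * c t * s) * (2 * c t * s))) (at t within {t0..})"
    using s unfolding corr_def[abs_def] s_def
    by (intro DERIV_divide c'_deriv assms) auto
  moreover have "(c'' t * (2 * c t * s) - c' t * ((2 * c' t) * s + c' t / (2 * s) * (2 * c t)))
        / ((2 * c t * s) * (2 * c t * s))
      = c'' t / (2 * c t * sqrt (c t)) - 3 * (c' t)\<^sup>2 / (4 * (c t)\<^sup>2 * sqrt (c t))"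
    unfolding s_def[symmetric] unfolding s(1) using s(2)
    by (simp add: field_simps power2_eq_square)
  ultimately show ?thesis by simp
qed

lemma corr_deriv_bound:
  assumes "t0 \<le> t"
  shows "\<bar>c'' t / (2 * c t * sqrt (c t)) - 3 * (c' t)\<^sup>2 / (4 * (c t)\<^sup>2 * sqrt (c t))\<bar> \<le> K * (\<gamma> t)\<^sup>2"
proof -
  note pos = c_pos[OF assms] c_bounds[OF assms] \<Lambda>1_pos
  have "(c' t)\<^sup>2 \<le> (\<gamma> t)\<^sup>2"
    using c'_bound[OF assms] \<gamma>_nonneg[OF assms] by (simp add: abs_le_square_iff[symmetric])
  then have 2: "\<bar>3 * (c' t)\<^sup>2 / (4 * (c t)\<^sup>2 * sqrt (c t))\<bar> \<le> 3 * (\<gamma> t)\<^sup>2 / (4 * \<Lambda>1\<^sup>2 * sqrt \<Lambda>1)"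
    unfolding abs_divide using pos by (intro frac_le) (auto simp: abs_mult intro!: mult_mono)
  have 1: "\<bar>c'' t / (2 * c t * sqrt (c t))\<bar> \<le> (\<gamma> t)\<^sup>2 / (2 * \<Lambda>1 * sqrt \<Lambda>1)"
    unfolding abs_divide using pos c''_bound[OF assms]
    by (intro frac_le) (auto simp: abs_mult intro!: mult_mono)
  have "K * (\<gamma> t)\<^sup>2 = (\<gamma> t)\<^sup>2 / (2 * \<Lambda>1 * sqrt \<Lambda>1) + 3 * (\<gamma> t)\<^sup>2 / (4 * \<Lambda>1\<^sup>2 * sqrt \<Lambda>1)"
    using pos by (simp add: K_def field_simps power2_eq_square)
  then show ?thesis using 1 2 by linarith
qed

lemma E0_nonneg: "t0 \<le> t \<Longrightarrow> 0 \<le> E0 t"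
  unfolding E0_def weighted_energy_def using X_nonneg Y_nonneg c_pos[of t] by simp

lemma W_le_E0:
  assumes "t0 \<le> t" shows "\<bar>W t\<bar> \<le> E0 t / (2 * a)"
proof -
  have "2 * (a * \<bar>W t\<bar>) \<le> E0 t"
    using W_bound[of t] two_sqrt_le_weighted_energy[of "c t" "X t" "Y t"] c_pos[OF assms] X_nonneg[of t] Y_nonneg[of t]
    unfolding E0_def by linarith
  then show ?thesis using a_pos by (simp add: field_simps)
qed

lemma T_between:
  assumes "t0 \<le> t" "\<gamma> t \<le> \<kappa> * a"
  shows "E0 t \<le> 2 * T t" "2 * T t \<le> 3 * E0 t"
proof -
  have "\<gamma> t / \<kappa> \<le> a"
    using assms(2) \<kappa>_pos by (simp add: pos_divide_le_eq mult.commute)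
  then have "\<bar>corr t\<bar> \<le> a"
    using corr_bound[OF assms(1)] by linarith
  then have "\<bar>corr t * W t\<bar> \<le> a * (E0 t / (2 * a))"
    unfolding abs_mult using W_le_E0[OF assms(1)] a_pos by (intro mult_mono) auto
  then have "\<bar>corr t * W t\<bar> \<le> E0 t / 2" using a_pos by simp
  then show "E0 t \<le> 2 * T t" "2 * T t \<le> 3 * E0 t"
    by (auto simp: T_def)
qed

lemma T_deriv:
  assumes "t0 \<le> t"
  shows "(T has_real_derivative
    (c'' t / (2 * c t * sqrt (c t)) - 3 * (c' t)\<^sup>2 / (4 * (c t)\<^sup>2 * sqrt (c t))) * W t) (at t within {t0..})"
proof -
  define s where "s = sqrt (c t)"
  have s: "c t = s\<^sup>2" "0 < s" using c_pos[OF assms] by (auto simp: s_def)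
  have "((\<lambda>t. sqrt (c t)) has_real_derivative c' t / (2 * s)) (at t within {t0..})"
    using c_pos[OF assms] unfolding s_def
    by (auto intro!: derivative_eq_intros c_deriv assms simp: field_simps)
  note rt = this
  have E0': "(E0 has_real_derivative
      ((- 2 * c t * V t) * s - X t * (c' t / (2 * s))) / (s * s)
      + (c' t / (2 * s) * Y t + 2 * V t * s)) (at t within {t0..})"
    using s unfolding E0_def[abs_def] weighted_energy_def s_def
    by (intro derivative_intros DERIV_divide DERIV_mult X_deriv Y_deriv rt[unfolded s_def] assms) auto
  have T': "(T has_real_derivative
      ((- 2 * c t * V t) * s - X t * (c' t / (2 * s))) / (s * s)
      + (c' t / (2 * s) * Y t + 2 * V t * s) +
      ((c'' t / (2 * c t * sqrt (c t)) - 3 * (c' t)\<^sup>2 / (4 * (c t)\<^sup>2 * sqrt (c t))) * W t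
       + (X t - c t * Y t) * corr t)) (at t within {t0..})"
    unfolding T_def[abs_def]
    by (intro DERIV_add E0' DERIV_mult corr_deriv W_deriv assms)
  have cancel: "((- 2 * c t * V t) * s - X t * (c' t / (2 * s))) / (s * s)
      + (c' t / (2 * s) * Y t + 2 * V t * s) + (X t - c t * Y t) * corr t = 0"
    unfolding corr_def s_def[symmetric] unfolding s(1) using s(2)
    by (simp add: field_simps power2_eq_square)
  have "p + r + (x + y) = x" if "p + r + y = 0" for p r x y :: real
    using that by linarith
  from T'[unfolded this[OF cancel]] show ?thesis .
qed

text \<open>
  Gronwall's inequality for \<open>T\<close>. The factor \<open>3\<close> is the loss in passing from \<open>T\<close> to its principal
  part \<open>E0\<close> at both ends; replacing the weight \<open>c\<close> by \<open>cinf\<close> costs \<open>\<surd>(\<Lambda>2 / \<Lambda>1)\<close> at each end.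
\<close>

lemma tarama_estimate:
  assumes "t0 \<le> s" and small: "\<And>x. x \<in> {t0..s} \<Longrightarrow> \<gamma> x \<le> \<kappa> * a"
  shows "E s \<le> 3 * \<Lambda>2 / \<Lambda>1 * E t0 * exp (K * G s / a)"
proof -
  define \<rho> where "\<rho> = sqrt (\<Lambda>2 / \<Lambda>1)"
  have \<rho>: "0 \<le> \<rho>" "\<rho> * \<rho> = \<Lambda>2 / \<Lambda>1" using \<Lambda>1_pos \<Lambda>1_le_\<Lambda>2 by (auto simp: \<rho>_def)
  have T: "T s \<le> T t0 * exp (integral {t0..s} (\<lambda>x. K / a * (\<gamma> x)\<^sup>2))"
  proof (rule gronwall_within[where f' = "\<lambda>t. (c'' t / (2 * c t * sqrt (c t)) - 3 * (c' t)\<^sup>2 / (4 * (c t)\<^sup>2 * sqrt (c t))) * W t"])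
    show "continuous_on {t0..s} (\<lambda>x. K / a * (\<gamma> x)\<^sup>2)"
      using a_pos by (intro continuous_intros continuous_on_subset[OF \<gamma>_cont]) auto
    fix x assume x: "x \<in> {t0..s}"
    then have "t0 \<le> x" by simp
    let ?q = "c'' x / (2 * c x * sqrt (c x)) - 3 * (c' x)\<^sup>2 / (4 * (c x)\<^sup>2 * sqrt (c x))"
    show "(T has_real_derivative ?q * W x) (at x within {t0..s})"
      using T_deriv[OF \<open>t0 \<le> x\<close>] by (rule DERIV_subset) auto
    have "?q * W x \<le> \<bar>?q\<bar> * \<bar>W x\<bar>"
      by (metis abs_ge_self abs_mult)
    also have "\<dots> \<le> (K * (\<gamma> x)\<^sup>2) * (E0 x / (2 * a))"
      using K_pos by (intro mult_mono corr_deriv_bound W_le_E0 \<open>t0 \<le> x\<close>) auto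
    also have "\<dots> \<le> (K * (\<gamma> x)\<^sup>2) * (2 * T x / (2 * a))"
      using K_pos a_pos T_between[OF \<open>t0 \<le> x\<close> small[OF x]] by (intro mult_left_mono divide_right_mono) auto
    finally show "?q * W x \<le> K / a * (\<gamma> x)\<^sup>2 * T x"
      using a_pos by simp
  qed fact
  have ex: "exp (integral {t0..s} (\<lambda>x. K / a * (\<gamma> x)\<^sup>2)) = exp (K * G s / a)"
    by (simp add: G_fun_def)
  have cmp: "E t \<le> \<rho> * E0 t" "E0 t \<le> \<rho> * E t" if "t0 \<le> t" for t
    unfolding E_def E0_def \<rho>_def using \<Lambda>1_pos cinf_bounds c_bounds[OF that] X_nonneg Y_nonneg
    by (auto intro!: weighted_energy_le_ratio)
  have "E s \<le> \<rho> * E0 s" using cmp assms by simp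
  also have "\<dots> \<le> \<rho> * (2 * T s)"
    using T_between[of s] small[of s] assms \<rho> by (intro mult_left_mono) auto
  also have "\<dots> \<le> \<rho> * ((2 * T t0) * exp (K * G s / a))"
    using T ex \<rho> by (intro mult_left_mono) auto
  also have "\<dots> \<le> \<rho> * ((3 * E0 t0) * exp (K * G s / a))"
    using T_between[of t0] small[of t0] assms \<rho> by (intro mult_left_mono mult_right_mono) auto
  also have "\<dots> \<le> \<rho> * ((3 * (\<rho> * E t0)) * exp (K * G s / a))"
    using cmp[of t0] \<rho> by (intro mult_left_mono mult_right_mono) auto
  also have "\<dots> = 3 * (\<rho> * \<rho>) * E t0 * exp (K * G s / a)"
    by (simp add: mult_ac)
  finally show ?thesis by (simp add: \<rho>)
qed

section \<open>Switching from one energy to the other\<close>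

text \<open>
  As long as the Tarama exponent is the smaller of \<open>K G s / a\<close> and \<open>a S s / \<surd>\<Lambda>1\<close>, it is at most
  their geometric mean, in which \<open>a\<close> cancels.
\<close>

lemma tarama_exponent_le:
  assumes "t0 \<le> s" "s \<le> t" and le: "K * G s \<le> a\<^sup>2 * S s / sqrt \<Lambda>1"
  shows "K * G s / a \<le> sqrt (K / sqrt \<Lambda>1) * sqrt (MM t)"
proof -
  have "(K * G s / a)\<^sup>2 = (K * G s) * (K * G s) / a\<^sup>2"
    by (simp add: power2_eq_square)
  also have "\<dots> \<le> (K * G s) * (a\<^sup>2 * S s / sqrt \<Lambda>1) / a\<^sup>2"
    using K_pos G_nonneg by (intro divide_right_mono mult_left_mono le) auto
  also have "\<dots> = K / sqrt \<Lambda>1 * (G s * S s)"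
    using a_pos by (simp add: field_simps)
  also have "\<dots> \<le> K / sqrt \<Lambda>1 * MM t"
    using K_pos \<Lambda>1_pos assms by (intro mult_left_mono GS_le_M) auto
  finally show ?thesis
    unfolding real_sqrt_mult[symmetric] by (rule real_le_rsqrt)
qed

text \<open>
  At the balance time \<open>s\<close> the Kovaleskian exponent on \<open>[s, t]\<close> is at most \<open>q\<close> times the Tarama
  exponent on \<open>[t0, s]\<close>, and the latter is bounded by the preceding lemma. If \<open>s = t\<close>, there is no
  second stage.
\<close>

lemma balanced_estimate:
  assumes q: "1 \<le> q" "b \<le> q * a" and s: "t0 \<le> s" "s \<le> t"
    and small: "\<And>x. x \<in> {t0..s} \<Longrightarrow> \<gamma> x \<le> \<kappa> * a"
    and le: "K * G s \<le> a\<^sup>2 * S s / sqrt \<Lambda>1"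
    and eq: "s = t \<or> K * G s = a\<^sup>2 * S s / sqrt \<Lambda>1"
  shows "E t \<le> E t0 * (3 * \<Lambda>2 / \<Lambda>1) * exp (q * (2 * sqrt (K / sqrt \<Lambda>1) * sqrt (MM t)))"
proof -
  let ?m = "sqrt (K / sqrt \<Lambda>1) * sqrt (MM t)"
  note m = tarama_exponent_le[OF s le]
  have m0: "0 \<le> ?m" using M_nonneg[of t] K_pos \<Lambda>1_pos s by auto
  have "b / sqrt \<Lambda>1 * integral {s..t} (\<lambda>x. \<bar>c x - cinf\<bar>) \<le> q * ?m"
  proof (cases "s = t")
    case True
    then show ?thesis using m0 q by simp
  next
    case False
    have "b / sqrt \<Lambda>1 * integral {s..t} (\<lambda>x. \<bar>c x - cinf\<bar>) \<le> b / sqrt \<Lambda>1 * S s"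
      using gap_integral_le[OF s(1)] b_nonneg \<Lambda>1_pos by (intro mult_left_mono) auto
    also have "\<dots> \<le> (q * a) / sqrt \<Lambda>1 * S s"
      using q S_nonneg[OF s(1)] \<Lambda>1_pos by (intro mult_right_mono divide_right_mono) auto
    also have "\<dots> = q * (K * G s / a)"
      using eq False a_pos by (simp add: power2_eq_square)
    also have "\<dots> \<le> q * ?m"
      using m q by (intro mult_left_mono) auto
    finally show ?thesis .
  qed
  moreover have "?m \<le> q * ?m"
    using mult_right_mono[OF q(1) m0] by simp
  ultimately have ex: "K * G s / a + b / sqrt \<Lambda>1 * integral {s..t} (\<lambda>x. \<bar>c x - cinf\<bar>) \<le> q * (2 * ?m)"
    using m by linarith
  have "E t \<le> E s * exp (b / sqrt \<Lambda>1 * integral {s..t} (\<lambda>x. \<bar>c x - cinf\<bar>))"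
    using s by (rule kovaleskian_estimate)
  also have "\<dots> \<le> (3 * \<Lambda>2 / \<Lambda>1 * E t0 * exp (K * G s / a)) * exp (b / sqrt \<Lambda>1 * integral {s..t} (\<lambda>x. \<bar>c x - cinf\<bar>))"
    using tarama_estimate[OF s(1) small] by (intro mult_right_mono) auto
  also have "\<dots> = 3 * \<Lambda>2 / \<Lambda>1 * E t0 * exp (K * G s / a + b / sqrt \<Lambda>1 * integral {s..t} (\<lambda>x. \<bar>c x - cinf\<bar>))"
    by (simp add: exp_add mult_ac)
  also have "\<dots> \<le> 3 * \<Lambda>2 / \<Lambda>1 * E t0 * exp (q * (2 * ?m))"
    using ex E_nonneg \<Lambda>1_pos \<Lambda>1_le_\<Lambda>2 by (intro mult_left_mono) auto
  finally show ?thesis by (simp add: mult_ac)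
qed

lemma balance_time:
  assumes "t0 \<le> t"
  obtains s where "t0 \<le> s" "s \<le> t" "K * G s \<le> a\<^sup>2 * S s / sqrt \<Lambda>1"
    "s = t \<or> K * G s = a\<^sup>2 * S s / sqrt \<Lambda>1"
proof -
  have "continuous_on {t0..t} (\<lambda>s. K * G s - a\<^sup>2 * S s / sqrt \<Lambda>1)"
    using \<Lambda>1_pos by (intro continuous_intros G_cont continuous_on_subset[OF S_cont]) auto
  moreover have "K * G t0 - a\<^sup>2 * S t0 / sqrt \<Lambda>1 \<le> 0"
    using S_nonneg[of t0] \<Lambda>1_pos by (simp add: G_fun_def)
  ultimately obtain s where "t0 \<le> s" "s \<le> t" "K * G s - a\<^sup>2 * S s / sqrt \<Lambda>1 \<le> 0"
    "s = t \<or> K * G s - a\<^sup>2 * S s / sqrt \<Lambda>1 = 0"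
    using balance_point[OF assms] by blast
  then show ?thesis using that[of s] by auto
qed

text \<open>
  Let \<open>d = \<Lambda>2 - \<Lambda>1\<close>. Until the time \<open>r\<close> with \<open>d (r - s) = S r\<close>, or until \<open>t\<close> if that comes first, the integral of \<open>\<bar>c - cinf\<bar>\<close> is
  estimated by \<open>d (r - s)\<close>, after it by \<open>S r\<close>, which is the same number. Since \<open>\<gamma> \<ge> \<gamma> s\<close> on
  \<open>[s, r]\<close>, the product \<open>G r S r \<le> M\<close> is at least \<open>(\<gamma> s)\<^sup>2 d (r - s)\<^sup>2\<close>, so \<open>\<gamma> s d (r - s)\<close> is
  at most \<open>\<surd>d \<surd>M\<close>. Finally \<open>b \<le> q \<gamma> s / \<kappa>\<close> turns this into a bound for the exponent.
\<close>

lemma second_phase: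
  assumes mono: "mono_on {t0..} \<gamma>" and q: "b \<le> q * a" "0 \<le> q" and s: "t0 \<le> s" "s \<le> t" and large: "\<kappa> * a \<le> \<gamma> s"
  shows "b / sqrt \<Lambda>1 * integral {s..t} (\<lambda>x. \<bar>c x - cinf\<bar>)
    \<le> q * (sqrt (\<Lambda>2 - \<Lambda>1) / \<Lambda>1\<^sup>2 * sqrt (MM t))"
proof -
  define d where "d = \<Lambda>2 - \<Lambda>1"
  have d: "0 \<le> d" using \<Lambda>1_le_\<Lambda>2 by (simp add: d_def)
  have "continuous_on {s..t} (\<lambda>r. d * (r - s) - S r)"
    using s by (intro continuous_intros continuous_on_subset[OF S_cont]) auto
  then obtain r where r: "s \<le> r" "r \<le> t" "d * (r - s) \<le> S r" "r = t \<or> d * (r - s) = S r"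
    using balance_point[of s t "\<lambda>r. d * (r - s) - S r"] s S_nonneg[of s] by auto
  define x where "x = r - s"
  have x: "0 \<le> x" using r by (simp add: x_def)
  have "integral {s..t} (\<lambda>x. \<bar>c x - cinf\<bar>) = integral {s..r} (\<lambda>x. \<bar>c x - cinf\<bar>) + integral {r..t} (\<lambda>x. \<bar>c x - cinf\<bar>)"
    using r s by (intro Henstock_Kurzweil_Integration.integral_combine[symmetric] gap_integrable) auto
  also have "integral {s..r} (\<lambda>x. \<bar>c x - cinf\<bar>) \<le> d * x"
    unfolding d_def x_def using r s by (intro gap_integral_le_length) auto
  also have "integral {r..t} (\<lambda>x. \<bar>c x - cinf\<bar>) \<le> d * x"
  proof (cases "r = t")
    case True then show ?thesis using d x by simp
  next
    case False
    then show ?thesis using gap_integral_le[of r t] r s by (simp add: x_def)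
  qed
  finally have I: "integral {s..t} (\<lambda>x. \<bar>c x - cinf\<bar>) \<le> 2 * (d * x)" by simp
  have "(\<gamma> s)\<^sup>2 * x = integral {s..r} (\<lambda>x. (\<gamma> s)\<^sup>2)"
    using r by (simp add: x_def)
  also have "\<dots> \<le> integral {s..r} (\<lambda>x. (\<gamma> x)\<^sup>2)"
    using s r mono by (intro integral_le \<gamma>2_integrable power_mono \<gamma>_nonneg) (auto simp: mono_on_def)
  also have "\<dots> \<le> G r"
    using G_diff[of s r] G_nonneg[of s] r s by simp
  finally have "((\<gamma> s)\<^sup>2 * x) * (d * x) \<le> G r * S r"
    using r x d G_nonneg by (intro mult_mono) (auto simp: x_def)
  also have "\<dots> \<le> MM t" using r s by (intro GS_le_M) auto
  finally have "(\<gamma> s * x * sqrt d)\<^sup>2 \<le> MM t"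
    using d by (simp add: power_mult_distrib) (simp add: power2_eq_square mult_ac)
  then have M: "\<gamma> s * x * sqrt d \<le> sqrt (MM t)" by (rule real_le_rsqrt)
  have "b / sqrt \<Lambda>1 * integral {s..t} (\<lambda>x. \<bar>c x - cinf\<bar>) \<le> b / sqrt \<Lambda>1 * (2 * (d * x))"
    using I b_nonneg \<Lambda>1_pos by (intro mult_left_mono) auto
  also have "\<dots> \<le> (q * a) / sqrt \<Lambda>1 * (2 * (d * x))"
    using q d x \<Lambda>1_pos by (intro mult_right_mono divide_right_mono) auto
  also have "\<dots> \<le> (q * (\<gamma> s / \<kappa>)) / sqrt \<Lambda>1 * (2 * (d * x))"
    using large q d x \<Lambda>1_pos \<kappa>_pos
    by (intro mult_right_mono divide_right_mono mult_left_mono) (auto simp: pos_le_divide_eq mult.commute)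
  also have "\<dots> = q * (sqrt d / \<Lambda>1\<^sup>2 * (\<gamma> s * x * sqrt d))"
    using d \<Lambda>1_pos by (simp add: \<kappa>_def field_simps power2_eq_square)
  also have "\<dots> \<le> q * (sqrt d / \<Lambda>1\<^sup>2 * sqrt (MM t))"
    using M q d by (intro mult_left_mono) auto
  finally show ?thesis by (simp add: d_def)
qed

lemma nondecreasing_estimate:
  assumes mono: "mono_on {t0..} \<gamma>" and q: "1 \<le> q" "b \<le> q * a" and t: "t0 \<le> t"
  shows "E t \<le> E t0 * (3 * \<Lambda>2 / \<Lambda>1) * exp (q * (max (2 * sqrt (\<Lambda>2 - \<Lambda>1) / \<Lambda>1\<^sup>2)
                          (sqrt (2 * \<Lambda>1 + 3) / \<Lambda>1 powr (3/2)) * sqrt (MM t)))"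
proof -
  let ?h = "sqrt (K / sqrt \<Lambda>1)"
  let ?l = "sqrt (\<Lambda>2 - \<Lambda>1) / \<Lambda>1\<^sup>2"
  let ?H = "max (2 * sqrt (\<Lambda>2 - \<Lambda>1) / \<Lambda>1\<^sup>2) (2 * ?h)"
  obtain s where s: "t0 \<le> s" "s \<le> t" "K * G s \<le> a\<^sup>2 * S s / sqrt \<Lambda>1"
    "s = t \<or> K * G s = a\<^sup>2 * S s / sqrt \<Lambda>1"
    using balance_time[OF t] .
  have H0: "0 \<le> 3 * \<Lambda>2 / \<Lambda>1" "1 \<le> 3 * \<Lambda>2 / \<Lambda>1" using \<Lambda>1_pos \<Lambda>1_le_\<Lambda>2 by (auto simp: field_simps)
  show ?thesis
  proof (cases "\<gamma> s \<le> \<kappa> * a")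
    case True
    then have "\<gamma> x \<le> \<kappa> * a" if "x \<in> {t0..s}" for x
      using mono_onD[OF mono, of x s] that s by auto
    from balanced_estimate[OF q s(1,2) this s(3,4)]
    have "E t \<le> E t0 * (3 * \<Lambda>2 / \<Lambda>1) * exp (q * (2 * ?h * sqrt (MM t)))" .
    also have "\<dots> \<le> E t0 * (3 * \<Lambda>2 / \<Lambda>1) * exp (q * (?H * sqrt (MM t)))"
    proof -
      have "q * (2 * ?h * sqrt (MM t)) \<le> q * (?H * sqrt (MM t))"
        using q M_nonneg[OF t] by (intro mult_left_mono mult_right_mono) auto
      then show ?thesis
        using H0 E_nonneg[of t0] by (intro mult_left_mono mult_nonneg_nonneg) auto
    qed
    finally show ?thesis by (simp only: H4_eq)
  next
    case False
    \<comment> \<open>Here \<open>\<gamma>\<close> reaches \<open>\<kappa> a\<close> before the balance time, at \<open>r\<close>; the Tarama energy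
      is used up to \<open>r\<close>, or not at all if \<open>\<gamma>\<close> is already too large at \<open>t0\<close>.\<close>
    have "\<exists>r\<in>{t0..s}. \<kappa> * a \<le> \<gamma> r \<and> E r \<le> (3 * \<Lambda>2 / \<Lambda>1) * E t0 * exp (?h * sqrt (MM t))"
    proof (cases "\<kappa> * a \<le> \<gamma> t0")
      case True
      have "0 \<le> ?h * sqrt (MM t)"
        using M_nonneg[OF t] K_pos \<Lambda>1_pos by auto
      then have "1 * E t0 * 1 \<le> (3 * \<Lambda>2 / \<Lambda>1) * E t0 * exp (?h * sqrt (MM t))"
        using H0 E_nonneg[of t0] by (intro mult_mono mult_nonneg_nonneg) auto
      then show ?thesis using True s by auto
    next
      case 2: False
      have "continuous_on {t0..s} (\<lambda>x. \<gamma> x - \<kappa> * a)"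
        by (intro continuous_intros continuous_on_subset[OF \<gamma>_cont]) auto
      then obtain r where r: "t0 \<le> r" "r \<le> s" "\<gamma> r = \<kappa> * a"
        using balance_point[of t0 s "\<lambda>x. \<gamma> x - \<kappa> * a"] 2 False s by auto
      have "K * G r \<le> K * G s"
        using G_mono[of r s] r K_pos by simp
      also have "\<dots> \<le> a\<^sup>2 * S s / sqrt \<Lambda>1" by fact
      also have "\<dots> \<le> a\<^sup>2 * S r / sqrt \<Lambda>1"
        using monotone_onD[OF S_anti, of r s] r s \<Lambda>1_pos by (intro divide_right_mono mult_left_mono) auto
      finally have "K * G r / a \<le> ?h * sqrt (MM t)"
        using r s by (intro tarama_exponent_le) auto
      moreover have "E r \<le> 3 * \<Lambda>2 / \<Lambda>1 * E t0 * exp (K * G r / a)"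
      proof (rule tarama_estimate)
        show "\<gamma> x \<le> \<kappa> * a" if "x \<in> {t0..r}" for x
          using mono_onD[OF mono, of x r] that r by auto
      qed (use r in auto)
      moreover have "0 \<le> 3 * \<Lambda>2 / \<Lambda>1 * E t0"
        using H0 E_nonneg[of t0] by (intro mult_nonneg_nonneg)
      ultimately have "E r \<le> 3 * \<Lambda>2 / \<Lambda>1 * E t0 * exp (?h * sqrt (MM t))"
        by (meson exp_le_cancel_iff mult_left_mono order_trans)
      then show ?thesis using r by (intro bexI[of _ r]) auto
    qed
    then obtain r where r: "t0 \<le> r" "r \<le> t" "\<kappa> * a \<le> \<gamma> r"
      and Er: "E r \<le> (3 * \<Lambda>2 / \<Lambda>1) * E t0 * exp (?h * sqrt (MM t))"
      using s by auto
    have "E t \<le> E r * exp (b / sqrt \<Lambda>1 * integral {r..t} (\<lambda>x. \<bar>c x - cinf\<bar>))"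
      using r by (intro kovaleskian_estimate)
    also have "\<dots> \<le> ((3 * \<Lambda>2 / \<Lambda>1) * E t0 * exp (?h * sqrt (MM t))) * exp (q * (?l * sqrt (MM t)))"
      using Er second_phase[OF mono q(2) _ r(1,2,3)] q H0 E_nonneg[of t0]
      by (intro mult_mono mult_nonneg_nonneg) auto
    also have "\<dots> = E t0 * (3 * \<Lambda>2 / \<Lambda>1) * exp (?h * sqrt (MM t) + q * (?l * sqrt (MM t)))"
      by (simp add: exp_add mult_ac)
    also have "\<dots> \<le> E t0 * (3 * \<Lambda>2 / \<Lambda>1) * exp (q * (?H * sqrt (MM t)))"
    proof -
      \<comment> \<open>Up to the factor \<open>q\<close>, either stage costs at most half of \<open>H\<^sub>2 \<surd>M\<close>.\<close>
      have "?h * sqrt (MM t) \<le> q * (?h * sqrt (MM t))"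
        using q M_nonneg[OF t] K_pos \<Lambda>1_pos mult_right_mono[of 1 q "?h * sqrt (MM t)"] by auto
      then have "?h * sqrt (MM t) + q * (?l * sqrt (MM t)) \<le> q * ((?h + ?l) * sqrt (MM t))"
        by (simp add: algebra_simps)
      also have "\<dots> \<le> q * (?H * sqrt (MM t))"
        using q M_nonneg[OF t] by (intro mult_left_mono mult_right_mono) auto
      finally show ?thesis
        using H0 E_nonneg[of t0] by (intro mult_left_mono mult_nonneg_nonneg) auto
    qed
    finally show ?thesis by (simp only: H4_eq)
  qed
qed

lemma nonincreasing_estimate:
  assumes anti: "antimono_on {t0..} \<gamma>" and q: "1 \<le> q" "b \<le> q * a" and t: "t0 \<le> t"
  shows "E t \<le> E t0 * max (3 * \<Lambda>2 / \<Lambda>1) (exp (q * (\<gamma> t0 * S t0 / (2 * \<Lambda>1\<^sup>2))))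
           * exp (q * (sqrt (2 * \<Lambda>1 + 3) / \<Lambda>1 powr (3/2) * sqrt (MM t)))"
proof -
  let ?h = "sqrt (K / sqrt \<Lambda>1)"
  let ?g = "exp (q * (\<gamma> t0 * S t0 / (2 * \<Lambda>1\<^sup>2)))"
  show ?thesis
  proof (cases "\<gamma> t0 \<le> \<kappa> * a")
    case True
    obtain s where s: "t0 \<le> s" "s \<le> t" "K * G s \<le> a\<^sup>2 * S s / sqrt \<Lambda>1"
      "s = t \<or> K * G s = a\<^sup>2 * S s / sqrt \<Lambda>1"
      using balance_time[OF t] .
    have "\<gamma> x \<le> \<kappa> * a" if "x \<in> {t0..s}" for x
      using monotone_onD[OF anti, of t0 x] that True by auto
    from balanced_estimate[OF q s(1,2) this s(3,4)]
    have "E t \<le> E t0 * (3 * \<Lambda>2 / \<Lambda>1) * exp (q * (2 * ?h * sqrt (MM t)))" .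
    also have "\<dots> \<le> E t0 * max (3 * \<Lambda>2 / \<Lambda>1) ?g * exp (q * (2 * ?h * sqrt (MM t)))"
      using E_nonneg[of t0] by (intro mult_right_mono mult_left_mono) auto
    finally show ?thesis by (simp only: H4_eq)
  next
    case False
    have "b / sqrt \<Lambda>1 * integral {t0..t} (\<lambda>x. \<bar>c x - cinf\<bar>) \<le> b / sqrt \<Lambda>1 * S t0"
      using gap_integral_le[of t0] b_nonneg \<Lambda>1_pos by (intro mult_left_mono) auto
    also have "\<dots> \<le> (q * (\<gamma> t0 / \<kappa>)) / sqrt \<Lambda>1 * S t0"
    proof -
      have "a \<le> \<gamma> t0 / \<kappa>" using False \<kappa>_pos by (simp add: pos_le_divide_eq mult.commute)
      then have "b \<le> q * (\<gamma> t0 / \<kappa>)" using q by (meson mult_left_mono order_trans zero_le_one)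
      then show ?thesis
        using S_nonneg[of t0] \<Lambda>1_pos by (intro mult_right_mono divide_right_mono) auto
    qed
    also have "\<dots> = q * (\<gamma> t0 * S t0 / (2 * \<Lambda>1\<^sup>2))"
      using \<Lambda>1_pos by (simp add: \<kappa>_def field_simps power2_eq_square)
    finally have "E t0 * exp (b / sqrt \<Lambda>1 * integral {t0..t} (\<lambda>x. \<bar>c x - cinf\<bar>)) \<le> E t0 * ?g"
      using E_nonneg[of t0] by (intro mult_left_mono) auto
    moreover have "E t \<le> E t0 * exp (b / sqrt \<Lambda>1 * integral {t0..t} (\<lambda>x. \<bar>c x - cinf\<bar>))"
      using t by (intro kovaleskian_estimate) auto
    ultimately have "E t \<le> E t0 * ?g * 1" by simp
    also have "\<dots> \<le> E t0 * max (3 * \<Lambda>2 / \<Lambda>1) ?g * exp (q * (2 * ?h * sqrt (MM t)))"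
      using E_nonneg[of t0] q M_nonneg[OF t] K_pos \<Lambda>1_pos
      by (intro mult_mono mult_left_mono mult_nonneg_nonneg) (auto simp: le_max_iff_disj)
    finally show ?thesis by (simp only: H4_eq)
  qed
qed

end

section \<open>Multipliers in the spectral representation\<close>

text \<open>
  Every statement about vectors is transported to an almost-everywhere statement about their images
  under \<open>F\<close>, and back by injectivity of \<open>F\<close> up to null sets.
\<close>

locale L2_representation =
  fixes M :: "'x measure" and F :: "'h::real_inner \<Rightarrow> 'x \<Rightarrow> real"
  assumes iso: "L2_surj_isometry M F"
begin

text \<open>
  The operator of multiplication by \<open>m\<close>; for \<open>m = lam\<close> this is \<open>sqrt_op\<close>. Its value at \<open>v\<close> is
  meaningful when \<open>m F v\<close> belongs to \<open>L2 M\<close>.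
\<close>

definition "mult_by m v = (THE w. AE x in M. F w x = m x * F v x)"

lemma F_meas [measurable]: "F u \<in> borel_measurable M"
  and F_int: "integrable M (\<lambda>x. (F u x)\<^sup>2)"
  using iso by (auto simp: L2_surj_isometry_def L2_def)

lemma F_add: "AE x in M. F (u + v) x = F u x + F v x"
  and F_scale: "AE x in M. F (r *\<^sub>R u) x = r * F u x"
  and F_surj: "f \<in> L2 M \<Longrightarrow> \<exists>u. AE x in M. F u x = f x"
  and norm_F: "norm u = sqrt (\<integral>x. (F u x)\<^sup>2 \<partial>M)"
  using iso by (auto simp: L2_surj_isometry_def)

lemma F_diff: "AE x in M. F (u - v) x = F u x - F v x"
  using F_add[of u "(-1) *\<^sub>R v"] F_scale[of "-1" v] by eventually_elim simp

lemma norm_sq_F: "(norm u)\<^sup>2 = (\<integral>x. (F u x)\<^sup>2 \<partial>M)"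
  unfolding norm_F by (rule real_sqrt_pow2) simp

lemma F_inj:
  assumes "AE x in M. F u x = F v x" shows "u = v"
proof -
  have "(norm (u - v))\<^sup>2 = (\<integral>x. 0 \<partial>M)"
    unfolding norm_sq_F
  proof (rule integral_cong_AE)
    show "AE x in M. (F (u - v) x)\<^sup>2 = 0"
      using F_diff[of u v] assms by eventually_elim simp
  qed auto
  then show ?thesis by simp
qed

lemma F_prod_int: "integrable M (\<lambda>x. F u x * F v x)"
proof (rule Bochner_Integration.integrable_bound)
  show "integrable M (\<lambda>x. (F u x)\<^sup>2 + (F v x)\<^sup>2)"
    by (intro Bochner_Integration.integrable_add F_int)
  have "\<bar>r * s\<bar> \<le> r\<^sup>2 + s\<^sup>2" for r s :: real
    using sum_squares_bound[of "\<bar>r\<bar>" "\<bar>s\<bar>"] mult_nonneg_nonneg[of "\<bar>r\<bar>" "\<bar>s\<bar>"]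
    unfolding abs_mult power2_abs mult.assoc by linarith
  then show "AE x in M. norm (F u x * F v x) \<le> norm ((F u x)\<^sup>2 + (F v x)\<^sup>2)"
    by simp
qed auto

lemma inner_F: "inner u v = (\<integral>x. F u x * F v x \<partial>M)"
proof -
  have "(norm (u + v))\<^sup>2 = (\<integral>x. (F u x)\<^sup>2 + (F v x)\<^sup>2 + 2 * (F u x * F v x) \<partial>M)"
    unfolding norm_sq_F
  proof (rule integral_cong_AE)
    show "AE x in M. (F (u + v) x)\<^sup>2 = (F u x)\<^sup>2 + (F v x)\<^sup>2 + 2 * (F u x * F v x)"
      using F_add[of u v] by eventually_elim (simp add: power2_sum)
  qed auto
  also have "\<dots> = (norm u)\<^sup>2 + (norm v)\<^sup>2 + 2 * (\<integral>x. F u x * F v x \<partial>M)"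
    by (simp add: norm_sq_F F_int F_prod_int)
  moreover have "(norm (u + v))\<^sup>2 = (norm u)\<^sup>2 + (norm v)\<^sup>2 + 2 * inner u v"
    by (simp add: power2_norm_eq_inner inner_add inner_commute)
  ultimately show ?thesis by simp
qed

lemma norm_le_F:
  assumes "AE x in M. \<bar>F u x\<bar> \<le> r * \<bar>F v x\<bar>" "0 \<le> r"
  shows "norm u \<le> r * norm v"
proof -
  have "(norm u)\<^sup>2 \<le> (\<integral>x. r\<^sup>2 * (F v x)\<^sup>2 \<partial>M)"
    unfolding norm_sq_F
  proof (rule integral_mono_AE)
    show "AE x in M. (F u x)\<^sup>2 \<le> r\<^sup>2 * (F v x)\<^sup>2"
      using assms(1)
    proof eventually_elim
      case (elim x)
      from power_mono[OF elim, of 2] show ?case by (simp add: power_mult_distrib)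
    qed
  qed (auto intro: F_int)
  also have "\<dots> = (r * norm v)\<^sup>2"
    by (simp add: norm_sq_F power_mult_distrib)
  finally show ?thesis
    using assms(2) by (intro power2_le_imp_le[of "norm u" "r * norm v"]) auto
qed

lemma F_mult:
  assumes "(\<lambda>x. m x * F v x) \<in> L2 M"
  shows "AE x in M. F (mult_by m v) x = m x * F v x"
  unfolding mult_by_def
proof (rule theI')
  obtain w where w: "AE x in M. F w x = m x * F v x"
    using F_surj[OF assms] by auto
  moreover have "w' = w" if "AE x in M. F w' x = m x * F v x" for w'
  proof (rule F_inj)
    show "AE x in M. F w' x = F w x" using that w by eventually_elim simp
  qed
  ultimately show "\<exists>!w. AE x in M. F w x = m x * F v x" by blast
qed

lemma F_L2: "F v \<in> L2 M"
  by (simp add: L2_def F_int)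

lemma bounded_mult_L2:
  assumes [measurable]: "m \<in> borel_measurable M" "f \<in> borel_measurable M"
    and f: "f \<in> L2 M" and m: "\<And>x. x \<in> space M \<Longrightarrow> \<bar>m x\<bar> \<le> r"
  shows "(\<lambda>x. m x * f x) \<in> L2 M"
proof -
  have "integrable M (\<lambda>x. (m x * f x)\<^sup>2)"
  proof (rule Bochner_Integration.integrable_bound)
    show "integrable M (\<lambda>x. r\<^sup>2 * (f x)\<^sup>2)" using f by (simp add: L2_def)
    have "(m x * f x)\<^sup>2 \<le> r\<^sup>2 * (f x)\<^sup>2" if "x \<in> space M" for x
      using power_mono[OF m[OF that], of 2]
      by (simp add: power_mult_distrib mult_right_mono)
    then show "AE x in M. norm ((m x * f x)\<^sup>2) \<le> norm (r\<^sup>2 * (f x)\<^sup>2)" by simp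
  qed auto
  then show ?thesis by (simp add: L2_def)
qed

end

text \<open>
  Bounded multipliers act on the whole space, as bounded symmetric operators.
\<close>

locale bounded_multiplier = L2_representation +
  fixes m :: "'a \<Rightarrow> real" and r :: real
  assumes m_meas [measurable]: "m \<in> borel_measurable M"
    and m_bound: "\<And>x. x \<in> space M \<Longrightarrow> \<bar>m x\<bar> \<le> r" and r_nonneg: "0 \<le> r"
begin

lemma F_bounded_mult: "AE x in M. F (mult_by m v) x = m x * F v x"
  by (rule F_mult[OF bounded_mult_L2[OF m_meas F_meas F_L2 m_bound]])

lemma norm_mult_le: "norm (mult_by m v) \<le> r * norm v"
proof (rule norm_le_F[OF _ r_nonneg])
  show "AE x in M. \<bar>F (mult_by m v) x\<bar> \<le> r * \<bar>F v x\<bar>"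
    using F_bounded_mult[of v] AE_space
  proof eventually_elim
    case (elim x)
    then show ?case using mult_right_mono[OF m_bound[OF elim(2)], of "\<bar>F v x\<bar>"] by (simp add: abs_mult)
  qed
qed

lemma bounded_linear_mult: "bounded_linear (mult_by m)"
proof (rule bounded_linear_intro)
  show "mult_by m (v + w) = mult_by m v + mult_by m w" for v w
  proof (rule F_inj)
    show "AE x in M. F (mult_by m (v + w)) x = F (mult_by m v + mult_by m w) x"
      using F_bounded_mult[of "v + w"] F_bounded_mult[of v] F_bounded_mult[of w]
        F_add[of v w] F_add[of "mult_by m v" "mult_by m w"]
    proof eventually_elim
      case (elim x)
      show ?case unfolding elim by (rule distrib_left)
    qed
  qed
  show "mult_by m (s *\<^sub>R v) = s *\<^sub>R mult_by m v" for s v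
  proof (rule F_inj)
    show "AE x in M. F (mult_by m (s *\<^sub>R v)) x = F (s *\<^sub>R mult_by m v) x"
      using F_bounded_mult[of "s *\<^sub>R v"] F_bounded_mult[of v]
        F_scale[of s v] F_scale[of s "mult_by m v"]
    proof eventually_elim
      case (elim x)
      show ?case unfolding elim by (rule mult.left_commute)
    qed
  qed
  show "norm (mult_by m v) \<le> norm v * r" for v
    by (subst mult.commute) (rule norm_mult_le)
qed

lemma inner_mult: "inner (mult_by m v) w = inner v (mult_by m w)"
  unfolding inner_F
proof (rule integral_cong_AE)
  show "AE x in M. F (mult_by m v) x * F w x = F v x * F (mult_by m w) x"
    using F_bounded_mult[of v] F_bounded_mult[of w] 
  proof eventually_elim
    case (elim x)
    show ?case unfolding elim by (simp only: mult_ac)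
  qed
qed (intro borel_measurable_times F_meas)+

end

section \<open>Frequency bands of a weak solution\<close>

locale solution = speed t0 \<Lambda>1 \<Lambda>2 cinf S \<gamma> c c' c'' + L2_representation M F
  for t0 \<Lambda>1 \<Lambda>2 cinf :: real and S \<gamma> c c' c'' :: "real \<Rightarrow> real"
    and M :: "'x measure" and F :: "'h::real_inner \<Rightarrow> 'x \<Rightarrow> real" +
  fixes lam :: "'x \<Rightarrow> real" and u u' :: "real \<Rightarrow> 'h"
  assumes lam_meas [measurable]: "lam \<in> borel_measurable M"
    and lam_nonneg: "x \<in> space M \<Longrightarrow> 0 \<le> lam x"
    and sol: "weak_solution (sqrt_dom M lam F) (sqrt_op M lam F) t0 c u u'"
begin

abbreviation "B \<equiv> sqrt_op M lam F"

lemma B_eq: "B = mult_by lam"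
  by (simp add: sqrt_op_def mult_by_def fun_eq_iff)

lemma F_B: "v \<in> sqrt_dom M lam F \<Longrightarrow> AE x in M. F (B v) x = lam x * F v x"
  unfolding B_eq sqrt_dom_def by (intro F_mult) simp

end

locale solution_band = solution +
  fixes \<Omega> :: "'a set" and a b :: real
  assumes \<Omega> [measurable]: "\<Omega> \<in> sets M"
    and a_nonneg: "0 \<le> a" and b_nn: "0 \<le> b" 
    and lam_ge: "x \<in> \<Omega> \<Longrightarrow> a \<le> lam x" and lam_le: "x \<in> \<Omega> \<Longrightarrow> lam x \<le> b"
begin

text \<open>
  \<open>P\<close> is the spectral projection onto the band, \<open>R\<close> the square root of the operator cut off
  to the band.
\<close>

definition "P = mult_by (indicator \<Omega>)"
definition "R = mult_by (\<lambda>x. indicator \<Omega> x * lam x)"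

sublocale P: bounded_multiplier M F "indicator \<Omega>" 1
  by unfold_locales (auto simp: indicator_def)

sublocale R: bounded_multiplier M F "\<lambda>x. indicator \<Omega> x * lam x" b
  using lam_nonneg lam_le b_nn by unfold_locales (auto simp: indicator_def abs_mult)

lemmas F_P = P.F_bounded_mult[folded P_def]
lemmas F_R = R.F_bounded_mult[folded R_def]

lemma R_P: "R (P v) = R v"
proof (rule F_inj)
  show "AE x in M. F (R (P v)) x = F (R v) x"
    using F_R[of "P v"] F_P[of v] F_R[of v] by eventually_elim (simp add: indicator_def)
qed

lemma P_dom: "P v \<in> sqrt_dom M lam F"
proof -
  have "integrable M (\<lambda>x. (lam x * F (P v) x)\<^sup>2)"
  proof (rule integrable_cong_AE_imp[OF F_int[of "R v"]])
    show "AE x in M. (F (R v) x)\<^sup>2 = (lam x * F (P v) x)\<^sup>2"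
      using F_R[of v] F_P[of v] by eventually_elim (simp add: indicator_def)
  qed (intro borel_measurable_power borel_measurable_times lam_meas F_meas)+
  moreover have "(\<lambda>x. lam x * F (P v) x) \<in> borel_measurable M"
    by (intro borel_measurable_times lam_meas F_meas)
  ultimately show ?thesis by (simp add: sqrt_dom_def L2_def)
qed

lemma B_P: "B (P v) = R v"
proof (rule F_inj)
  show "AE x in M. F (B (P v)) x = F (R v) x"
    using F_B[OF P_dom[of v]] F_P[of v] F_R[of v] by eventually_elim (simp add: indicator_def)
qed

lemma P_B: "v \<in> sqrt_dom M lam F \<Longrightarrow> P (B v) = R v"
proof (rule F_inj)
  assume v: "v \<in> sqrt_dom M lam F"
  show "AE x in M. F (P (B v)) x = F (R v) x"
    using F_B[OF v] F_P[of "B v"] F_R[of v] by eventually_elim (simp add: indicator_def)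
qed

lemma R_B: "v \<in> sqrt_dom M lam F \<Longrightarrow> R (B v) = R (R v)"
  using P_B R_P by metis

lemma lower_bound: "a * norm (P v) \<le> norm (R v)"
proof -
  have "norm (a *\<^sub>R P v) \<le> 1 * norm (R v)"
  proof (rule norm_le_F)
    show "AE x in M. \<bar>F (a *\<^sub>R P v) x\<bar> \<le> 1 * \<bar>F (R v) x\<bar>"
      using F_scale[of a "P v"] F_P[of v] F_R[of v]
    proof eventually_elim
      case (elim x)
      then show ?case
        using lam_ge[of x] a_nonneg by (auto simp: indicator_def abs_mult intro!: mult_right_mono)
    qed
  qed simp
  then show ?thesis using a_nonneg by simp
qed

lemma u_deriv: "t0 \<le> t \<Longrightarrow> (u has_vector_derivative u' t) (at t within {t0..})"
  and u_dom: "t0 \<le> t \<Longrightarrow> u t \<in> sqrt_dom M lam F"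
  and u_cont: "continuous_on {t0..} u"
  and u'_weak: "\<phi> \<in> sqrt_dom M lam F \<Longrightarrow> t0 \<le> t \<Longrightarrow> ((\<lambda>s. inner (u' s) \<phi>) has_real_derivative
        - c t * inner (B (u t)) (B \<phi>)) (at t within {t0..})"
  using sol unfolding weak_solution_def by blast+

lemma P_u_deriv: "t0 \<le> t \<Longrightarrow> ((\<lambda>s. P (u s)) has_vector_derivative P (u' t)) (at t within {t0..})"
  unfolding P_def by (rule bounded_linear.has_vector_derivative[OF P.bounded_linear_mult u_deriv])

lemma R_u_deriv: "t0 \<le> t \<Longrightarrow> ((\<lambda>s. R (u s)) has_vector_derivative R (u' t)) (at t within {t0..})"
  unfolding R_def by (rule bounded_linear.has_vector_derivative[OF R.bounded_linear_mult u_deriv])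

text \<open>
  Testing the weak equation with \<open>P \<phi>\<close>, which lies in the domain for every \<open>\<phi>\<close>, moves both
  factors \<open>B\<close> onto the band, where they become the bounded operator \<open>R\<close>. The right-hand side is
  then continuous in norm, and the weak derivative is a strong one.
\<close>

lemma P_u'_deriv:
  assumes "t0 \<le> t"
  shows "((\<lambda>s. P (u' s)) has_vector_derivative - c t *\<^sub>R R (R (u t))) (at t within {t0..})"
proof (rule weak_derivative_imp_strong[OF _ _ assms])
  show "continuous_on {t0..} (\<lambda>t. - c t *\<^sub>R R (R (u t)))"
    unfolding R_def
    by (intro continuous_on_scaleR continuous_on_minus c_cont
        bounded_linear.continuous_on[OF R.bounded_linear_mult u_cont]
        bounded_linear.continuous_on[OF R.bounded_linear_mult])
  fix \<phi> t assume t: "t0 \<le> t"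
  have "inner (B (u t)) (B (P \<phi>)) = inner (R (R (u t))) \<phi>"
    unfolding B_P R_B[OF u_dom[OF t], symmetric] unfolding R_def by (rule R.inner_mult[symmetric])
  then show "((\<lambda>s. inner (P (u' s)) \<phi>) has_real_derivative inner (- c t *\<^sub>R R (R (u t))) \<phi>) (at t within {t0..})"
    using u'_weak[OF P_dom t, of \<phi>] P.inner_mult[folded P_def] by simp
qed

definition "X t = (norm (P (u' t)))\<^sup>2"
definition "Y t = (norm (R (u t)))\<^sup>2"
definition "V t = inner (R (u t)) (R (u' t))"
definition "W t = inner (P (u t)) (P (u' t))"

lemma sqrt_XY: "sqrt (X t * Y t) = norm (P (u' t)) * norm (R (u t))"
  by (simp add: X_def Y_def real_sqrt_mult)

sublocale band t0 \<Lambda>1 \<Lambda>2 cinf S \<gamma> c c' c'' X Y V b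
proof unfold_locales
  fix t assume t: "t0 \<le> t"
  have *: "inner (P (u' t)) (R (R (u t))) = V t"
    using R.inner_mult[of "P (u' t)" "R (u t)"] R_P[of "u' t"]
    by (simp add: V_def inner_commute flip: R_def)
  show "(X has_real_derivative - 2 * c t * V t) (at t within {t0..})"
    using has_real_derivative_inner[OF P_u'_deriv[OF t] P_u'_deriv[OF t]] *
    by (simp add: X_def[abs_def] power2_norm_eq_inner inner_commute mult.assoc)
  show "(Y has_real_derivative 2 * V t) (at t within {t0..})"
    using has_real_derivative_inner[OF R_u_deriv[OF t] R_u_deriv[OF t]]
    by (simp add: Y_def[abs_def] power2_norm_eq_inner V_def inner_commute)
next
  fix t
  have "\<bar>V t\<bar> \<le> norm (R (u t)) * norm (R (P (u' t)))"
    unfolding V_def R_P by (rule Cauchy_Schwarz_ineq2)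
  also have "\<dots> \<le> norm (R (u t)) * (b * norm (P (u' t)))"
    unfolding R_def by (intro mult_left_mono R.norm_mult_le) auto
  finally show "\<bar>V t\<bar> \<le> b * sqrt (X t * Y t)"
    by (simp add: sqrt_XY mult_ac)
qed (auto simp: X_def Y_def b_nn)

lemma positive_band:
  assumes "0 < a" shows "positive_band t0 \<Lambda>1 \<Lambda>2 cinf S \<gamma> c c' c'' X Y V b W a"
proof unfold_locales
  fix t assume t: "t0 \<le> t"
  have "inner (P (u t)) (R (R (u t))) = Y t"
    using R.inner_mult[of "P (u t)" "R (u t)"] R_P[of "u t"]
    by (simp add: Y_def power2_norm_eq_inner flip: R_def)
  then show "(W has_real_derivative X t - c t * Y t) (at t within {t0..})"
    using has_real_derivative_inner[OF P_u_deriv[OF t] P_u'_deriv[OF t]]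
    by (simp add: W_def[abs_def] X_def power2_norm_eq_inner)
next
  fix t
  have "a * \<bar>W t\<bar> \<le> a * (norm (P (u t)) * norm (P (u' t)))"
    unfolding W_def using a_nonneg by (intro mult_left_mono Cauchy_Schwarz_ineq2)
  also have "\<dots> \<le> norm (R (u t)) * norm (P (u' t))"
    using lower_bound[of "u t"] by (simp add: mult.assoc[symmetric] mult_right_mono)
  finally show "a * \<bar>W t\<bar> \<le> sqrt (X t * Y t)"
    by (simp add: sqrt_XY mult_ac)
qed (use assms in auto)

lemma E_eq: "t0 \<le> t \<Longrightarrow> E t = weighted_energy cinf ((norm (P (u' t)))\<^sup>2) ((norm (P (B (u t))))\<^sup>2)"
  by (simp add: E_def X_def Y_def P_B u_dom)

end

section \<open>Summation over the bands\<close>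

text \<open>
  Partial sums are integrals of \<open>(F v)\<^sup>2\<close> over \<open>{n < N}\<close>, and these sets exhaust the space.
\<close>

lemma (in L2_representation) norm_sq_sums_bands:
  fixes n :: "'x \<Rightarrow> nat"
  assumes n [measurable]: "n \<in> measurable M (count_space UNIV)"
  shows "(\<lambda>k. (norm (mult_by (indicator {x \<in> space M. n x = k}) v))\<^sup>2) sums (norm v)\<^sup>2"
proof -
  let ?\<Omega> = "\<lambda>k. {x \<in> space M. n x = k}"
  have sets: "?\<Omega> k \<in> sets M" for k by measurable
  have band_norm: "(norm (mult_by (indicator (?\<Omega> k)) v))\<^sup>2 = (\<integral>x. indicator (?\<Omega> k) x * (F v x)\<^sup>2 \<partial>M)" for k
  proof -
    interpret P: bounded_multiplier M F "indicator (?\<Omega> k)" 1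
      using sets by unfold_locales (auto simp: indicator_def)
    show ?thesis
      unfolding norm_sq_F
    proof (rule integral_cong_AE)
      show "AE x in M. (F (mult_by (indicator (?\<Omega> k)) v) x)\<^sup>2 = indicator (?\<Omega> k) x * (F v x)\<^sup>2"
        using P.F_bounded_mult[of v] by eventually_elim (simp add: indicator_def)
    qed (use sets in \<open>auto intro!: borel_measurable_times borel_measurable_power F_meas borel_measurable_indicator\<close>)
  qed
  have int: "integrable M (\<lambda>x. indicator (?\<Omega> k) x * (F v x)\<^sup>2)" for k
    using integrable_real_mult_indicator[OF sets F_int[of v]] by (simp add: mult.commute)
  have "(\<Sum>k<N. (norm (mult_by (indicator (?\<Omega> k)) v))\<^sup>2) = (\<integral>x. (if n x < N then (F v x)\<^sup>2 else 0) \<partial>M)" for N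
  proof -
    have "(\<Sum>k<N. (norm (mult_by (indicator (?\<Omega> k)) v))\<^sup>2)
        = (\<integral>x. (\<Sum>k<N. indicator (?\<Omega> k) x * (F v x)\<^sup>2) \<partial>M)"
      unfolding band_norm by (rule Bochner_Integration.integral_sum[symmetric]) (rule int)
    also have "\<dots> = (\<integral>x. (if n x < N then (F v x)\<^sup>2 else 0) \<partial>M)"
    proof (rule Bochner_Integration.integral_cong[OF refl])
      fix x assume "x \<in> space M"
      then have "(\<Sum>k<N. indicator (?\<Omega> k) x * (F v x)\<^sup>2) = (\<Sum>k<N. if n x = k then (F v x)\<^sup>2 else 0)"
        by (intro sum.cong) (auto simp: indicator_def)
      then show "(\<Sum>k<N. indicator (?\<Omega> k) x * (F v x)\<^sup>2) = (if n x < N then (F v x)\<^sup>2 else 0)"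
        by simp
    qed
    finally show ?thesis .
  qed
  moreover have "(\<lambda>N. \<integral>x. (if n x < N then (F v x)\<^sup>2 else 0) \<partial>M) \<longlonglongrightarrow> (\<integral>x. (F v x)\<^sup>2 \<partial>M)"
  proof (rule integral_dominated_convergence[OF _ _ F_int[of v]])
    show "AE x in M. (\<lambda>N. if n x < N then (F v x)\<^sup>2 else 0) \<longlonglongrightarrow> (F v x)\<^sup>2"
    proof (rule AE_I2)
      fix x
      have "\<forall>\<^sub>F N in sequentially. (if n x < N then (F v x)\<^sup>2 else 0) = (F v x)\<^sup>2"
        using eventually_gt_at_top[of "n x"] by eventually_elim simp
      then show "(\<lambda>N. if n x < N then (F v x)\<^sup>2 else 0) \<longlonglongrightarrow> (F v x)\<^sup>2"
        by (rule tendsto_eventually)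
    qed
  qed auto
  ultimately show ?thesis
    by (simp add: sums_def norm_sq_F)
qed

context solution
begin

text \<open>
  The band with number \<open>Suc j\<close> consists of the frequencies whose logarithm to the base \<open>q\<close> has
  integer part \<open>int_decode j\<close>, so it lies between \<open>a\<close> and \<open>q a\<close> for a power \<open>a\<close> of \<open>q\<close>. Band \<open>0\<close>
  carries the frequency zero, where the energy cannot grow.
\<close>

lemma energy_le_of_bands:
  assumes q: "1 < q" and "1 \<le> C" and t: "t0 \<le> t"
    and est: "\<And>X Y V W a b. positive_band t0 \<Lambda>1 \<Lambda>2 cinf S \<gamma> c c' c'' X Y V b W a \<Longrightarrow> b \<le> q * a \<Longrightarrow>
      weighted_energy cinf (X t) (Y t) \<le> weighted_energy cinf (X t0) (Y t0) * C"
  shows "energy B cinf u u' t \<le> energy B cinf u u' t0 * C"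
proof -
  define n where "n x = (if lam x = 0 then 0 else Suc (int_encode \<lfloor>ln (lam x) / ln q\<rfloor>))" for x
  have n [measurable]: "n \<in> measurable M (count_space UNIV)"
    unfolding n_def[abs_def] by measurable
  define \<Omega> where "\<Omega> k = {x \<in> space M. n x = k}" for k
  have \<Omega>: "\<Omega> k \<in> sets M" for k unfolding \<Omega>_def by measurable
  define e where "e k s = weighted_energy cinf ((norm (mult_by (indicator (\<Omega> k)) (u' s)))\<^sup>2)
    ((norm (mult_by (indicator (\<Omega> k)) (B (u s))))\<^sup>2)" for k s
  have sums: "(\<lambda>k. e k s) sums energy B cinf u u' s" for s
    unfolding e_def weighted_energy_def energy_def \<Omega>_def
    by (intro sums_add sums_divide sums_mult norm_sq_sums_bands n)
  have "e k t \<le> e k t0 * C" for k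
  proof (cases k)
    case 0
    have "lam x = 0" if "x \<in> \<Omega> k" for x
      using that 0 by (auto simp: \<Omega>_def n_def split: if_splits)
    then interpret band: solution_band t0 \<Lambda>1 \<Lambda>2 cinf S \<gamma> c c' c'' M F lam u u' "\<Omega> k" 0 0
      by unfold_locales (use \<Omega> in auto)
    have "e k t \<le> e k t0 * 1"
      using band.kovaleskian_estimate[of t0 t] t by (simp add: band.E_eq e_def band.P_def)
    also have "\<dots> \<le> e k t0 * C"
      using band.E_nonneg[of t0] \<open>1 \<le> C\<close> by (intro mult_left_mono) (simp_all add: band.E_eq e_def band.P_def)
    finally show ?thesis .
  next
    case (Suc j)
    define a where "a = exp (ln q * real_of_int (int_decode j))"
    have a: "0 < a" by (simp add: a_def)
    have lam: "a \<le> lam x \<and> lam x \<le> q * a" if "x \<in> \<Omega> k" for x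
    proof -
      have x: "0 < lam x" "int_encode \<lfloor>ln (lam x) / ln q\<rfloor> = j"
        using that Suc lam_nonneg[of x] by (auto simp: \<Omega>_def n_def split: if_splits)
      then have "\<lfloor>ln (lam x) / ln q\<rfloor> = int_decode j" by auto
      then have "int_decode j \<le> ln (lam x) / ln q" "ln (lam x) / ln q < int_decode j + 1"
        by linarith+
      then have "ln q * int_decode j \<le> ln (lam x)" "ln (lam x) \<le> ln q + ln q * int_decode j"
        using q by (simp_all add: field_simps)
      then have "exp (ln q * int_decode j) \<le> exp (ln (lam x))"
          "exp (ln (lam x)) \<le> exp (ln q + ln q * int_decode j)"
        unfolding exp_le_cancel_iff .
      then show ?thesis
        using q x unfolding a_def by (simp add: exp_add)
    qed
    interpret band: solution_band t0 \<Lambda>1 \<Lambda>2 cinf S \<gamma> c c' c'' M F lam u u' "\<Omega> k" a "q * a"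
      by unfold_locales (use \<Omega> a q lam in auto)
    show ?thesis
      using est[OF band.positive_band[OF a] order_refl]
      unfolding band.E_def[symmetric] using t
      by (simp add: band.E_eq e_def band.P_def)
  qed
  then show ?thesis
    using sums_le[OF _ sums[of t] sums_mult2[OF sums[of t0], of C]] by simp
qed

end

lemma le_at_one_of_le_right:
  fixes f :: "real \<Rightarrow> real"
  assumes "isCont f 1" "\<And>q. 1 < q \<Longrightarrow> x \<le> f q"
  shows "x \<le> f 1"
proof (rule tendsto_lowerbound)
  show "(f \<longlongrightarrow> f 1) (at_right 1)"
    using assms(1) by (simp add: isCont_def filterlim_at_split)
  show "\<forall>\<^sub>F q in at_right 1. x \<le> f q"
    using assms(2) by (auto simp: eventually_at_right_less intro: eventually_mono[OF eventually_at_right_less])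
qed simp

theorem theorem2p4:
  fixes t0 \<Lambda>1 \<Lambda>2 cinf :: real
    and S \<gamma> c :: "real \<Rightarrow> real"
    and M :: "'x measure" and lam :: "'x \<Rightarrow> real"
    and F :: "'h::{real_inner, complete_space} \<Rightarrow> 'x \<Rightarrow> real"
    and D :: "'h set" and A :: "'h \<Rightarrow> 'h"
    and u u' :: "real \<Rightarrow> 'h"
  assumes "0 < \<Lambda>1" and "\<Lambda>1 \<le> \<Lambda>2"
    and "continuous_on {t0..} S" and "antimono_on {t0..} S" and "(S \<longlongrightarrow> 0) at_top"
    and "continuous_on {t0..} \<gamma>" and "mono_on {t0..} \<gamma> \<or> antimono_on {t0..} \<gamma>"
    and "multiplication_operator M lam F D A"
    and "c \<in> PS t0 \<Lambda>1 \<Lambda>2 S \<gamma>" and "limit_speed t0 S c cinf"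
    and "weak_solution (sqrt_dom M lam F) (sqrt_op M lam F) t0 c u u'"
  shows "(mono_on {t0..} \<gamma> \<longrightarrow>
           (\<forall>t\<ge>t0. energy (sqrt_op M lam F) cinf u u' t
             \<le> energy (sqrt_op M lam F) cinf u u' t0 * (3 * \<Lambda>2 / \<Lambda>1)
               * exp (max (2 * sqrt (\<Lambda>2 - \<Lambda>1) / \<Lambda>1\<^sup>2)
                          (sqrt (2 * \<Lambda>1 + 3) / \<Lambda>1 powr (3/2))
                      * sqrt (M_fun t0 S \<gamma> t))))
       \<and> (antimono_on {t0..} \<gamma> \<longrightarrow>
           (\<forall>t\<ge>t0. energy (sqrt_op M lam F) cinf u u' t
             \<le> energy (sqrt_op M lam F) cinf u u' t0
               * max (3 * \<Lambda>2 / \<Lambda>1) (exp (\<gamma> t0 * S t0 / (2 * \<Lambda>1\<^sup>2)))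
               * exp (sqrt (2 * \<Lambda>1 + 3) / \<Lambda>1 powr (3/2)
                      * sqrt (M_fun t0 S \<gamma> t))))"
proof -
  obtain c' c'' where c: "\<forall>t\<ge>t0. \<Lambda>1 \<le> c t \<and> c t \<le> \<Lambda>2"
      "\<forall>t\<ge>t0. (c has_real_derivative c' t) (at t within {t0..})"
      "\<forall>t\<ge>t0. (c' has_real_derivative c'' t) (at t within {t0..})"
      "\<forall>t\<ge>t0. \<bar>c' t\<bar> \<le> \<gamma> t \<and> \<bar>c'' t\<bar> \<le> (\<gamma> t)\<^sup>2"
    using \<open>c \<in> PS t0 \<Lambda>1 \<Lambda>2 S \<gamma>\<close> unfolding PS_def by blast
  interpret solution t0 \<Lambda>1 \<Lambda>2 cinf S \<gamma> c c' c'' M F lam u u'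
    using assms(8) by unfold_locales (use assms c in \<open>simp_all add: multiplication_operator_def\<close>)
  let ?H4 = "sqrt (2 * \<Lambda>1 + 3) / \<Lambda>1 powr (3/2)"
  let ?H2 = "max (2 * sqrt (\<Lambda>2 - \<Lambda>1) / \<Lambda>1\<^sup>2) ?H4"
  let ?g = "\<gamma> t0 * S t0 / (2 * \<Lambda>1\<^sup>2)"
  have H: "1 \<le> 3 * \<Lambda>2 / \<Lambda>1" "0 \<le> ?H4" "0 \<le> ?H2"
    using \<Lambda>1_pos \<Lambda>1_le_\<Lambda>2 by (auto simp: field_simps le_max_iff_disj)
  show ?thesis
  proof (intro conjI impI allI)
    fix t assume mono: "mono_on {t0..} \<gamma>" and t: "t0 \<le> t"
    define f where "f q = energy B cinf u u' t0 * (3 * \<Lambda>2 / \<Lambda>1) * exp (q * (?H2 * sqrt (MM t)))" for q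
    have "energy B cinf u u' t \<le> f 1"
    proof (rule le_at_one_of_le_right)
      show "isCont f 1" unfolding f_def[abs_def] by (intro continuous_intros)
      fix q :: real assume q: "1 < q"
      have "0 \<le> q * (?H2 * sqrt (MM t))"
        using H q M_nonneg[OF t] by (intro mult_nonneg_nonneg) auto
      then have "1 * 1 \<le> (3 * \<Lambda>2 / \<Lambda>1) * exp (q * (?H2 * sqrt (MM t)))"
        using H by (intro mult_mono) auto
      then have "energy B cinf u u' t \<le> energy B cinf u u' t0 * ((3 * \<Lambda>2 / \<Lambda>1) * exp (q * (?H2 * sqrt (MM t))))"
      proof (intro energy_le_of_bands[OF q _ t])
        fix X Y V W :: "real \<Rightarrow> real" and a b :: real
        assume "positive_band t0 \<Lambda>1 \<Lambda>2 cinf S \<gamma> c c' c'' X Y V b W a" and ab: "b \<le> q * a"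
        then interpret band: positive_band t0 \<Lambda>1 \<Lambda>2 cinf S \<gamma> c c' c'' X Y V b W a by simp
        show "weighted_energy cinf (X t) (Y t)
          \<le> weighted_energy cinf (X t0) (Y t0) * ((3 * \<Lambda>2 / \<Lambda>1) * exp (q * (?H2 * sqrt (MM t))))"
          using band.nondecreasing_estimate[OF mono _ ab t] q by (simp add: band.E_def mult.assoc)
      qed simp
      then show "energy B cinf u u' t \<le> f q" by (simp add: f_def mult.assoc)
    qed
    then show "energy B cinf u u' t \<le> energy B cinf u u' t0 * (3 * \<Lambda>2 / \<Lambda>1) * exp (?H2 * sqrt (MM t))"
      by (simp add: f_def)
  next
    fix t assume anti: "antimono_on {t0..} \<gamma>" and t: "t0 \<le> t"
    define f where "f q = energy B cinf u u' t0 * max (3 * \<Lambda>2 / \<Lambda>1) (exp (q * ?g)) * exp (q * (?H4 * sqrt (MM t)))" for q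
    have "energy B cinf u u' t \<le> f 1"
    proof (rule le_at_one_of_le_right)
      show "isCont f 1" unfolding f_def[abs_def] by (intro continuous_intros)
      fix q :: real assume q: "1 < q"
      have "0 \<le> q * (?H4 * sqrt (MM t))"
        using H q M_nonneg[OF t] by (intro mult_nonneg_nonneg) auto
      then have "1 * 1 \<le> max (3 * \<Lambda>2 / \<Lambda>1) (exp (q * ?g)) * exp (q * (?H4 * sqrt (MM t)))"
        using H by (intro mult_mono) (auto simp: le_max_iff_disj)
      then have "energy B cinf u u' t \<le> energy B cinf u u' t0 *
          (max (3 * \<Lambda>2 / \<Lambda>1) (exp (q * ?g)) * exp (q * (?H4 * sqrt (MM t))))"
      proof (intro energy_le_of_bands[OF q _ t])
        fix X Y V W :: "real \<Rightarrow> real" and a b :: real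
        assume "positive_band t0 \<Lambda>1 \<Lambda>2 cinf S \<gamma> c c' c'' X Y V b W a" and ab: "b \<le> q * a"
        then interpret band: positive_band t0 \<Lambda>1 \<Lambda>2 cinf S \<gamma> c c' c'' X Y V b W a by simp
        show "weighted_energy cinf (X t) (Y t) \<le> weighted_energy cinf (X t0) (Y t0) *
          (max (3 * \<Lambda>2 / \<Lambda>1) (exp (q * ?g)) * exp (q * (?H4 * sqrt (MM t))))"
          using band.nonincreasing_estimate[OF anti _ ab t] q by (simp add: band.E_def mult.assoc)
      qed simp
      then show "energy B cinf u u' t \<le> f q" by (simp add: f_def mult.assoc)
    qed
    then show "energy B cinf u u' t \<le> energy B cinf u u' t0
        * max (3 * \<Lambda>2 / \<Lambda>1) (exp ?g) * exp (?H4 * sqrt (MM t))"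
      by (simp add: f_def)
  qed
qed

end
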